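(* Let $F:\mathbb{R}^2\times\mathbb{R}^2\to\mathbb{R}$ satisfy, for all $p,q,q_1,q_2\in\mathbb{R}^2$: $F$ is continuous; $F(p,\theta q_1+(1-\theta)q_2)\le\theta F(p,q_1)+(1-\theta)F(p,q_2)$ for all $\theta\in[0,1]$; $F(p,\lambda q)=\lambda F(p,q)$ for all $\lambda>0$; there exist $m_1,m_2>0$ with $m_1|q|\le F(p,q)\le m_2|q|$; and $F(p+n,q)=F(p,q)$ for all $n\in\mathbb{Z}^2$. Then for every $\tau\in\mathbb{R}$ there exists a Lipschitz continuous $1$-periodic $u_\tau\in\mathcal{M}_\tau$ such that $\mathcal{F}(u_\tau)=S_F(\tau)$.
   Context: $W^{1,1}$ denotes the space of $u\in W^{1,1}_{loc}(\mathbb{R};\mathbb{R}^2)$ with $u(t+1)=u(t)$ for all $t$. For $u\in W^{1,1}$: $\mathcal{F}(u)=\int_0^1F(u,\dot u)\,dt$ and $\mathcal{A}(u)=\frac12\int_0^1u\cdot i\dot u\,dt$, where $\mathbb{R}^2\cong\mathbb{C}$ and $ip$ is the rotation of $p$ by $\pi/2$. $\mathcal{M}_\tau=\{u\in W^{1,1}:\mathcal{A}(u)=\tau\}$ and $S_F(\tau)=\inf_{v\in\mathcal{M}_\tau}\mathcal{F}(v)$. *)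

theory Defs
  imports "HOL-Analysis.Analysis"
begin

text \<open>R^2 is identified with the complex plane; i p is multiplication by the imaginary unit.\<close>

text \<open>W^{1,1}_loc(R;R^2): u has a locally (absolutely) integrable weak derivative v,
  i.e. u b - u a is the integral of v over [a,b] for all a \<le> b.\<close>
definition W11loc :: "(real \<Rightarrow> complex) \<Rightarrow> bool" where
  "W11loc u \<longleftrightarrow> (\<exists>v. \<forall>a b. a \<le> b \<longrightarrow>
       v absolutely_integrable_on {a..b} \<and> (v has_integral (u b - u a)) {a..b})"

definition W11per :: "(real \<Rightarrow> complex) set" where
  "W11per = {u. W11loc u \<and> (\<forall>t. u (t + 1) = u t)}"

text \<open>The derivative dot u (defined almost everywhere; coincides a.e. with the weak derivative).\<close>
definition Fcal :: "(complex \<Rightarrow> complex \<Rightarrow> real) \<Rightarrow> (real \<Rightarrow> complex) \<Rightarrow> real" where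
  "Fcal F u = integral {0..1} (\<lambda>t. F (u t) (vector_derivative u (at t)))"

definition Acal :: "(real \<Rightarrow> complex) \<Rightarrow> real" where
  "Acal u = (1/2) * integral {0..1} (\<lambda>t. u t \<bullet> (\<i> * vector_derivative u (at t)))"

definition Mset :: "real \<Rightarrow> (real \<Rightarrow> complex) set" where
  "Mset \<tau> = {u \<in> W11per. Acal u = \<tau>}"

definition S_F :: "(complex \<Rightarrow> complex \<Rightarrow> real) \<Rightarrow> real \<Rightarrow> real" where
  "S_F F \<tau> = Inf (Fcal F ` Mset \<tau>)"

end

theory Submission
  imports Defs "HOL-Complex_Analysis.Great_Picard"
begin

text \<open>The direct method, carried out with polygonal sums so that no change of variables is needed.
  The curves of a minimizing sequence, translated by lattice vectors, have bounded length, so their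
  arclength reparametrizations are equi-Lipschitz and a subsequence converges uniformly to some W.
  For an integrand G that is convex and positively homogeneous in the velocity, Jensen's inequality bounds
  the sums of G(w(k/N), w((k+1)/N) - w(k/N)) by the integral of the original curve up to an error that is
  small in N uniformly along the sequence, and these sums depend only on finitely many points of the
  reparametrized curve w. One can therefore let the curves tend to W first and N tend to infinity
  afterwards; for the Lipschitz curve W the sums converge to the integral by dominated convergence.
  Taking for G the integrand F and plus and minus the area integrand shows that W has the prescribed
  area and minimizes. The a.e. derivative in the definitions is identified with the
  weak derivative by Lebesgue's differentiation theorem, obtained from Henstock's lemma and Vitali coverings.\<close>

section \<open>Weak derivatives on the line\<close>

text \<open>The intervals between t and the bad points s form a Vitali cover; on a disjoint finite subfamily
  Henstock's lemma bounds the total error, and hence c times the total length.\<close>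

lemma negligible_bad_difference_quotients:
  fixes u v :: "real \<Rightarrow> 'a::euclidean_space"
  assumes prim: "\<And>s t. \<lbrakk>a \<le> s; s \<le> t; t \<le> b\<rbrakk> \<Longrightarrow> (v has_integral (u t - u s)) {s..t}"
    and "c > 0"
  shows "negligible {t \<in> {a<..<b}. \<forall>d>0. \<exists>s\<in>{a<..<b}. s \<noteq> t \<and> \<bar>s - t\<bar> < d \<and>
           norm (u s - u t - (s - t) *\<^sub>R v t) \<ge> c * \<bar>s - t\<bar>}" (is "negligible ?E")
proof (cases "a \<le> b")
  case False
  then show ?thesis by simp
next
  case True
  show ?thesis
    unfolding negligible_outer_le
  proof (intro allI impI)
    fix e :: real assume "e > 0"
    have "v integrable_on cbox a b"
      using prim[of a b] True by auto
    moreover have "c * e > 0" using \<open>c > 0\<close> \<open>e > 0\<close> by simp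
    ultimately obtain \<gamma> where \<gamma>: "gauge \<gamma>"
      and hen: "\<And>p. \<lbrakk>p tagged_partial_division_of (cbox a b); \<gamma> fine p\<rbrakk> \<Longrightarrow>
             sum (\<lambda>(x,k). norm(measure lborel k *\<^sub>R v x - integral k v)) p < c * e"
      by (rule Henstock_lemma) blast
    \<comment> \<open>The tag \<open>t\<close> is an endpoint of its interval, not the centre.
      \<open>ctr\<close> and \<open>rad\<close> describe the same interval as a ball, the form in
      which the Vitali theorem takes its cover.\<close>
    define ctr rad where "ctr = (\<lambda>(t::real,s::real). (t + s) / 2)" and "rad = (\<lambda>(t::real,s::real). \<bar>s - t\<bar> / 2)"
    define I where "I i = cball (ctr i) (rad i)" for i
    define K where "K = {(t,s). t \<in> {a<..<b} \<and> s \<in> {a<..<b} \<and> s \<noteq> t \<and> I (t,s) \<subseteq> \<gamma> t \<and>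
        norm (u s - u t - (s - t) *\<^sub>R v t) \<ge> c * \<bar>s - t\<bar>}"
    have I_eq: "I (t,s) = cbox (min t s) (max t s)" for t s
      by (cases "t \<le> s") (simp_all add: I_def ctr_def rad_def cball_eq_atLeastAtMost min_def max_def field_simps)
    have cov: "\<exists>i. i \<in> K \<and> t \<in> cball (ctr i) (rad i) \<and> rad i < d" if tE: "t \<in> ?E" and "d > 0" for t d
    proof -
      obtain r where r: "r > 0" "ball t r \<subseteq> \<gamma> t"
        using \<gamma> by (meson gaugeD open_contains_ball)
      obtain s where s: "s\<in>{a<..<b}" "s \<noteq> t" "\<bar>s - t\<bar> < min d r"
         "norm (u s - u t - (s - t) *\<^sub>R v t) \<ge> c * \<bar>s - t\<bar>"
      proof -
        have "min d r > 0" using \<open>d > 0\<close> r by simp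
        then show thesis using tE that by blast
      qed
      have "I (t,s) \<subseteq> ball t r"
        using s(3) unfolding I_eq by (auto simp: dist_real_def)
      then have "(t,s) \<in> K" using s r tE by (auto simp: K_def)
      moreover have "t \<in> I (t,s)" by (simp add: I_eq)
      moreover have "rad (t,s) < d" using s(3) \<open>d > 0\<close> by (auto simp: rad_def)
      ultimately show ?thesis unfolding I_def by blast
    qed
    have pos: "0 < rad i" if "i \<in> K" for i
      using that by (auto simp: K_def rad_def)
    obtain C where C: "countable C" "C \<subseteq> K"
       "pairwise (\<lambda>i j. disjnt (cball (ctr i) (rad i)) (cball (ctr j) (rad j))) C"
       "negligible (?E - (\<Union>i \<in> C. cball (ctr i) (rad i)))"
      by (rule Vitali_covering_theorem_cballs[OF pos cov])
    have disj: "disjnt (I i) (I j)" if "i \<in> C" "j \<in> C" "i \<noteq> j" for i j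
      using C(3) that by (auto simp: pairwise_def I_def)
    have lm: "I i \<in> lmeasurable" for i by (simp add: I_def)
    have fin: "measure lebesgue (\<Union> (I ` C')) \<le> e" if C': "C' \<subseteq> C" "finite C'" for C'
    proof -
      define p where "p = (\<lambda>i. (fst i, I i)) ` C'"
      \<comment> \<open>Distinct members of the disjoint family cannot share a nonempty interval, so
        the sum over \<open>p\<close> can be reindexed by \<open>C'\<close> without losing
        terms.\<close>
      have inj: "inj_on (\<lambda>i. (fst i, I i)) C'"
      proof (rule inj_onI)
        fix i j assume ij: "i \<in> C'" "j \<in> C'" "(fst i, I i) = (fst j, I j)"
        have "I i \<noteq> {}" by (cases i) (simp add: I_eq)
        then show "i = j" using disj[of i j] ij C' by (auto simp: disjnt_def)
      qed
      have part: "p tagged_partial_division_of (cbox a b)"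
        unfolding tagged_partial_division_of_def
      proof (intro conjI allI impI)
        show "finite p" using C' by (simp add: p_def)
      next
        fix x k assume "(x,k) \<in> p"
        then obtain s where s: "(x,s) \<in> C'" "k = I (x,s)" by (auto simp: p_def)
        then have "(x,s) \<in> K" using C' C by auto
        then have xs: "x \<in> {a<..<b}" "s \<in> {a<..<b}" by (auto simp: K_def)
        show "x \<in> k" using s by (simp add: I_eq)
        show "k \<subseteq> cbox a b" using s xs by (auto simp: I_eq)
        show "\<exists>a b. k = cbox a b" using s I_eq by blast
      next
        fix x1 k1 x2 k2 assume *: "(x1,k1) \<in> p \<and> (x2,k2) \<in> p \<and> (x1,k1) \<noteq> (x2,k2)"
        then obtain i j where ij: "i \<in> C'" "k1 = I i" "x1 = fst i" "j \<in> C'" "k2 = I j" "x2 = fst j"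
          by (auto simp: p_def)
        with * have "i \<noteq> j" by auto
        then have "disjnt k1 k2" using disj ij C' by blast
        then show "interior k1 \<inter> interior k2 = {}"
          using interior_subset unfolding disjnt_def by blast
      qed
      have fine: "\<gamma> fine p"
      proof -
        have "I i \<subseteq> \<gamma> (fst i)" if "i \<in> C'" for i
        proof -
          have "i \<in> K" using C(2) C'(1) that by blast
          then show ?thesis by (cases i) (simp add: K_def)
        qed
        then show ?thesis by (auto simp: fine_def p_def)
      qed
      \<comment> \<open>On each interval the Henstock error is, up to sign, the remainder of the
        difference quotient at the tag, on whichever side of \<open>t\<close> the point
        \<open>s\<close> lies.\<close>
      have ge: "c * measure lebesgue (I i) \<le> norm (measure lborel (I i) *\<^sub>R v (fst i) - integral (I i) v)"
        if "i \<in> C'" for i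
      proof -
        obtain t s where i: "i = (t,s)" by (cases i)
        then have "(t,s) \<in> K" using that C' C by auto
        then have ts: "t \<in> {a<..<b}" "s \<in> {a<..<b}" 
           and bad: "norm (u s - u t - (s - t) *\<^sub>R v t) \<ge> c * \<bar>s - t\<bar>" by (auto simp: K_def)
        have meas: "measure lebesgue (I i) = \<bar>s - t\<bar>"
          unfolding i I_eq by (auto simp: min_def max_def)
        have cont: "measure lborel (I i) = \<bar>s - t\<bar>"
          unfolding i I_eq by (auto simp: min_def max_def)
        have int: "integral (I i) v = u (max t s) - u (min t s)"
          unfolding i I_eq using prim[of "min t s" "max t s"] ts by (auto intro: integral_unique)
        have "norm (measure lborel (I i) *\<^sub>R v (fst i) - integral (I i) v)
            = norm (u s - u t - (s - t) *\<^sub>R v t)"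
        proof (cases "t \<le> s")
          case True
          then show ?thesis
            unfolding cont int by (simp add: i norm_minus_commute)
        next
          case False
          then have "measure lborel (I i) *\<^sub>R v (fst i) - integral (I i) v = u s - u t - (s - t) *\<^sub>R v t"
            unfolding cont int by (simp add: i algebra_simps)
          then show ?thesis by simp
        qed
        then show ?thesis using bad meas by simp
      qed
      have "c * measure lebesgue (\<Union> (I ` C')) \<le> c * (\<Sum>i\<in>C'. measure lebesgue (I i))"
        using \<open>c > 0\<close> C' lm by (intro mult_left_mono measure_UNION_le) (auto simp: fmeasurableD)
      also have "\<dots> \<le> (\<Sum>i\<in>C'. norm (measure lborel (I i) *\<^sub>R v (fst i) - integral (I i) v))"
        unfolding sum_distrib_left by (intro sum_mono ge)
      also have "\<dots> = sum (\<lambda>(x,k). norm(measure lborel k *\<^sub>R v x - integral k v)) p"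
        unfolding p_def by (subst sum.reindex[OF inj]) simp
      also have "\<dots> < c * e" using hen[OF part fine] .
      finally show ?thesis using \<open>c > 0\<close> by simp
    qed
    let ?N = "?E - \<Union> (I ` C)"
    have N: "negligible ?N" using C(4) by (simp add: I_def)
    have U: "\<Union> (I ` C) \<in> lmeasurable" "measure lebesgue (\<Union> (I ` C)) \<le> e"
      using fmeasurable_UN_bound[of C I lebesgue e] measure_UN_bound[of C I lebesgue e] C(1) lm fin by auto
    show "\<exists>T. ?E \<subseteq> T \<and> T \<in> lmeasurable \<and> measure lebesgue T \<le> e"
    proof (intro exI conjI)
      show "?E \<subseteq> \<Union> (I ` C) \<union> ?N" by blast
      show "\<Union> (I ` C) \<union> ?N \<in> lmeasurable"
        using U N by (intro fmeasurable.Un) (auto intro: negligible_imp_measurable)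
      show "measure lebesgue (\<Union> (I ` C) \<union> ?N) \<le> e"
        using U N measure_Un_le[of "\<Union> (I ` C)" lebesgue ?N] negligible_imp_measure0[OF N] 
          negligible_imp_measurable[OF N] by (auto simp: fmeasurableD)
    qed
  qed
qed

text \<open>If \<open>v t\<close> is not the derivative of \<open>u\<close> at \<open>t\<close>,
  then for some \<open>n\<close> the remainder exceeds \<open>inverse (Suc n)\<close> times the
  distance at points arbitrarily close to \<open>t\<close>. Each such set is null by the previous
  lemma, and there are countably many of them.\<close>

theorem has_vector_derivative_indefinite_integral_ae:
  fixes u v :: "real \<Rightarrow> 'a::euclidean_space"
  assumes prim: "\<And>s t. \<lbrakk>a \<le> s; s \<le> t; t \<le> b\<rbrakk> \<Longrightarrow> (v has_integral (u t - u s)) {s..t}"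
  obtains N where "negligible N" "\<And>t. t \<in> {a<..<b} - N \<Longrightarrow> (u has_vector_derivative v t) (at t)"
proof -
  define E where "E n = {t \<in> {a<..<b}. \<forall>d>0. \<exists>s\<in>{a<..<b}. s \<noteq> t \<and> \<bar>s - t\<bar> < d \<and>
           norm (u s - u t - (s - t) *\<^sub>R v t) \<ge> inverse (real (Suc n)) * \<bar>s - t\<bar>}" for n
  have "negligible (\<Union>n. E n)"
    unfolding E_def using negligible_bad_difference_quotients[OF prim]
    by (intro negligible_countable_Union) auto
  moreover have "(u has_vector_derivative v t) (at t)" if t: "t \<in> {a<..<b} - (\<Union>n. E n)" for t
    unfolding has_vector_derivative_def has_derivative_within_alt
  proof (intro conjI allI impI)
    show "bounded_linear (\<lambda>x. x *\<^sub>R v t)" by (rule bounded_linear_scaleR_left)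
  next
    fix e :: real assume "e > 0"
    then obtain n where n: "inverse (real (Suc n)) < e" using reals_Archimedean by blast
    have "\<not> (\<forall>d>0. \<exists>s\<in>{a<..<b}. s \<noteq> t \<and> \<bar>s - t\<bar> < d \<and>
           norm (u s - u t - (s - t) *\<^sub>R v t) \<ge> inverse (real (Suc n)) * \<bar>s - t\<bar>)"
      using t unfolding E_def by blast
    then obtain d where d: "d > 0" "\<And>s. \<lbrakk>s \<in> {a<..<b}; s \<noteq> t; \<bar>s - t\<bar> < d\<rbrakk> \<Longrightarrow>
       norm (u s - u t - (s - t) *\<^sub>R v t) < inverse (real (Suc n)) * \<bar>s - t\<bar>"
      by (force simp: not_le simp del: of_nat_Suc)
    obtain d' where d': "d' > 0" "ball t d' \<subseteq> {a<..<b}"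
      using t by (meson DiffD1 open_contains_ball open_greaterThanLessThan)
    show "\<exists>d>0. \<forall>y\<in>UNIV. norm (y - t) < d \<longrightarrow> norm (u y - u t - (y - t) *\<^sub>R v t) \<le> e * norm (y - t)"
    proof (intro exI conjI ballI impI)
      show "min d d' > 0" using d d' by simp
    next
      fix y assume y: "norm (y - t) < min d d'"
      show "norm (u y - u t - (y - t) *\<^sub>R v t) \<le> e * norm (y - t)"
      proof (cases "y = t")
        case False
        have "y \<in> {a<..<b}" using y d' by (auto simp: subset_iff dist_real_def abs_minus_commute)
        then have "norm (u y - u t - (y - t) *\<^sub>R v t) \<le> inverse (real (Suc n)) * \<bar>y - t\<bar>"
          using d(2)[of y] False y by fastforce
        also have "\<dots> \<le> e * \<bar>y - t\<bar>" using n by (intro mult_right_mono) auto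
        finally show ?thesis by simp
      qed simp
    qed
  qed
  ultimately show thesis using that by blast
qed

section \<open>Lipschitz functions as indefinite integrals\<close>

text \<open>The density is the Radon-Nikodym derivative of the image of Lebesgue measure under the inverse of g,
  which assigns mass g b - g a to the interval [a,b].\<close>

lemma bilipschitz_increasing_density:
  fixes g :: "real \<Rightarrow> real"
  assumes "c > 0"
    and lower: "\<And>x y. x \<le> y \<Longrightarrow> c * (y - x) \<le> g y - g x"
    and upper: "\<And>x y. x \<le> y \<Longrightarrow> g y - g x \<le> M * (y - x)"
  obtains f :: "real \<Rightarrow> real" where "\<And>x. 0 \<le> f x"
    "\<And>a b. a \<le> b \<Longrightarrow> (f has_integral (g b - g a)) {a..b}"
proof -
  have lt: "g x < g y" if "x < y" for x y
    using lower[of x y] that \<open>c > 0\<close> mult_pos_pos[of c "y - x"] by linarith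
  then have sm: "strict_mono g" by (simp add: strict_mono_def)
  have lip: "\<bar>g x - g y\<bar> \<le> M * \<bar>x - y\<bar>" for x y
    using upper[of x y] upper[of y x] lt[of x y] lt[of y x] by (cases x y rule: linorder_cases) auto
  have "M \<ge> 0" using lip[of 0 1] by simp
  have contg: "continuous_on UNIV g"
  proof (rule lipschitz_on_continuous_on)
    show "M-lipschitz_on UNIV g"
      using lip \<open>M \<ge> 0\<close> by (intro lipschitz_onI) (auto simp: dist_real_def)
  qed
  have surj: "surj g"
    unfolding surj_def
  proof
    fix y
    define r where "r = \<bar>y - g 0\<bar> / c"
    have "r \<ge> 0" "c * r = \<bar>y - g 0\<bar>" using \<open>c > 0\<close> by (auto simp: r_def)
    then have "g (-r) \<le> y" "y \<le> g r" using lower[of "-r" 0] lower[of 0 r] by auto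
    then obtain x where "g x = y"
      using IVT'[of g "-r" y r] \<open>r \<ge> 0\<close> continuous_on_subset[OF contg] by auto
    then show "\<exists>x. y = g x" by blast
  qed
  define h where "h = inv g"
  have gh: "g (h y) = y" for y unfolding h_def using surj by (rule surj_f_inv_f)
  have hg: "h (g x) = x" for x unfolding h_def using strict_mono_imp_inj_on[OF sm] by (rule inv_f_f)
  have hm: "h y \<le> x \<longleftrightarrow> y \<le> g x" "x \<le> h y \<longleftrightarrow> g x \<le> y" for x y
    using strict_mono_less_eq[OF sm] gh by metis+
  have "mono h" using hm gh by (metis monoI order_trans)
  then have h_meas [measurable]: "h \<in> borel_measurable borel" by (rule borel_measurable_mono)
  define \<mu> where "\<mu> = distr lborel borel h"
  have vim: "h -` A = g ` A" for A using gh hg by (auto intro!: image_eqI[of _ g "h _"])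
  \<comment> \<open>The preimage of \<open>N\<close> under \<open>h\<close> is its image under
    \<open>g\<close>, and a Lipschitz map sends null sets to null sets.\<close>
  have "absolutely_continuous lborel \<mu>"
    unfolding absolutely_continuous_def
  proof
    fix N :: "real set" assume N: "N \<in> null_sets lborel"
    then have [measurable]: "N \<in> sets borel" by auto
    have "negligible N" using N null_sets_completionI negligible_iff_null_sets by blast
    then have "negligible (g ` N)"
      by (rule negligible_locally_Lipschitz_image[rotated])
         (use lip in \<open>auto intro!: exI[of _ UNIV] exI[of _ M]\<close>)
    then have "negligible (h -` N)" by (simp add: vim)
    moreover have "h -` N \<in> sets borel"
      using measurable_sets[OF h_meas, of N] by simp
    ultimately have "emeasure lborel (h -` N) = 0"
      using null_sets_completion_iff[of "h -` N" lborel] by (auto simp: negligible_iff_null_sets null_sets_def)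
    then show "N \<in> null_sets \<mu>"
      by (auto simp: \<mu>_def null_sets_def emeasure_distr)
  qed
  moreover have "sets \<mu> = sets lborel" by (simp add: \<mu>_def)
  ultimately obtain f where [measurable]: "f \<in> borel_measurable lborel" and f: "density lborel f = \<mu>"
    using sigma_finite_measure.Radon_Nikodym[OF sigma_finite_lborel] by blast
  have "((\<lambda>x. enn2real (f x)) has_integral (g b - g a)) {a..b}" if "a \<le> b" for a b
  proof -
    have gab: "g a \<le> g b" using that strict_mono_less_eq[OF sm] by simp
    have "h -` {a..b} = {g a..g b}" using hm by auto
    then have "emeasure \<mu> {a..b} = ennreal (g b - g a)"
      using gab by (simp add: \<mu>_def emeasure_distr)
    then have I: "(\<integral>\<^sup>+x. f x * indicator {a..b} x \<partial>lborel) = ennreal (g b - g a)"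
      unfolding f[symmetric] by (simp add: emeasure_density)
    \<comment> \<open>A Radon-Nikodym density may take the value infinity. Its integral over
      \<open>{a..b}\<close> is finite, so it is finite a.e. there and \<open>enn2real\<close> leaves
      the integral unchanged.\<close>
    then have "AE x in lborel. f x * indicator {a..b} x \<noteq> \<infinity>"
      by (intro nn_integral_PInf_AE) auto
    then have "AE x in lborel. ennreal (enn2real (f x) * indicator {a..b} x) = f x * indicator {a..b} x"
      by eventually_elim (auto simp: indicator_def top.not_eq_extremum)
    then have "(\<integral>\<^sup>+x. ennreal (enn2real (f x) * indicator {a..b} x) \<partial>lborel) = ennreal (g b - g a)"
      unfolding I[symmetric] by (rule nn_integral_cong_AE)
    then have "((\<lambda>x. enn2real (f x) * indicator {a..b} x) has_integral (g b - g a)) UNIV"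
      using gab by (intro nn_integral_has_integral) auto
    moreover have "(\<lambda>x. enn2real (f x) * indicator {a..b} x) = (\<lambda>x. if x \<in> {a..b} then enn2real (f x) else 0)"
      by (auto simp: indicator_def)
    ultimately show ?thesis using has_integral_restrict_UNIV[of "{a..b}"] by metis
  qed
  then show thesis using that[of "\<lambda>x. enn2real (f x)"] by simp
qed

text \<open>Adding \<open>(L + 1) * t\<close> to a component gives a function with slopes between 1
  and \<open>2 * L + 1\<close>, to which the previous lemma applies; the constant is then subtracted
  from the density. Nonnegativity of the density makes the integrability absolute.\<close>

lemma lipschitz_has_weak_derivative:
  fixes w :: "real \<Rightarrow> 'a::euclidean_space"
  assumes "L-lipschitz_on UNIV w"
  obtains v where "\<And>a b. a \<le> b \<Longrightarrow> v absolutely_integrable_on {a..b}"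
    "\<And>a b. a \<le> b \<Longrightarrow> (v has_integral (w b - w a)) {a..b}"
proof -
  have L: "L \<ge> 0" using assms lipschitz_on_nonneg by blast
  have "\<exists>f::real \<Rightarrow> real. (\<forall>x. 0 \<le> f x) \<and>
     (\<forall>a b. a \<le> b \<longrightarrow> (f has_integral ((w b \<bullet> i + (L + 1) * b) - (w a \<bullet> i + (L + 1) * a))) {a..b})"
    if "i \<in> Basis" for i
  proof -
    have *: "\<bar>w y \<bullet> i - w x \<bullet> i\<bar> \<le> L * (y - x)" if "x \<le> y" for x y
    proof -
      have "\<bar>w y \<bullet> i - w x \<bullet> i\<bar> = \<bar>(w y - w x) \<bullet> i\<bar>" by (simp add: inner_diff_left)
      also have "\<dots> \<le> norm (w y - w x)" using \<open>i \<in> Basis\<close> by (rule Basis_le_norm)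
      also have "\<dots> \<le> L * (y - x)" using lipschitz_onD[OF assms, of y x] that by (simp add: dist_norm)
      finally show ?thesis .
    qed
    show ?thesis
    proof (rule bilipschitz_increasing_density[of 1 "\<lambda>t. w t \<bullet> i + (L + 1) * t" "2 * L + 1"])
      fix x y :: real assume "x \<le> y"
      from *[OF this] show "1 * (y - x) \<le> w y \<bullet> i + (L + 1) * y - (w x \<bullet> i + (L + 1) * x)"
        "w y \<bullet> i + (L + 1) * y - (w x \<bullet> i + (L + 1) * x) \<le> (2 * L + 1) * (y - x)"
        by (auto simp: algebra_simps)
    qed auto
  qed
  then obtain f :: "'a \<Rightarrow> real \<Rightarrow> real" where f0: "\<And>i x. i \<in> Basis \<Longrightarrow> 0 \<le> f i x"
    and f: "\<And>i a b. \<lbrakk>i \<in> Basis; a \<le> b\<rbrakk> \<Longrightarrow>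
       (f i has_integral ((w b \<bullet> i + (L + 1) * b) - (w a \<bullet> i + (L + 1) * a))) {a..b}"
    by metis
  define v where "v t = (\<Sum>i\<in>Basis. (f i t - (L + 1)) *\<^sub>R i)" for t
  have vi: "v t \<bullet> i = f i t - (L + 1)" if "i \<in> Basis" for t i
    using that by (simp add: v_def)
  show thesis
  proof
    fix a b :: real assume ab: "a \<le> b"
    have "((\<lambda>t. f i t - (L + 1)) has_integral 
        ((w b \<bullet> i + (L + 1) * b) - (w a \<bullet> i + (L + 1) * a)) - (L + 1) * (b - a)) {a..b}" if "i \<in> Basis" for i
      using has_integral_diff[OF f[OF that ab] has_integral_const_real[of "L + 1" a b]] ab 
      by (simp add: mult.commute)
    then show "(v has_integral (w b - w a)) {a..b}"
      by (subst has_integral_componentwise_iff) (simp add: vi inner_diff_left algebra_simps)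
    have "(\<lambda>t. f i t - (L + 1)) absolutely_integrable_on {a..b}" if i: "i \<in> Basis" for i
    proof (rule set_integral_diff(1))
      show "f i absolutely_integrable_on {a..b}"
        using f[OF i ab] f0[OF i] by (intro nonnegative_absolutely_integrable_1) auto
      show "(\<lambda>t. L + 1) absolutely_integrable_on {a..b}"
        by (intro absolutely_integrable_continuous_real) auto
    qed
    then show "v absolutely_integrable_on {a..b}"
      by (subst absolutely_integrable_componentwise_iff) (simp add: vi)
  qed
qed

section \<open>Parametric Lagrangians and polygonal sums\<close>

lemma has_integral_sum_partition:
  fixes f :: "real \<Rightarrow> 'a::banach" and t :: "nat \<Rightarrow> real"
  assumes "\<And>k. k < N \<Longrightarrow> t k \<le> t (Suc k)"
    and "\<And>k. k < N \<Longrightarrow> (f has_integral I k) {t k..t (Suc k)}"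
  shows "t 0 \<le> t N \<and> (f has_integral (\<Sum>k<N. I k)) {t 0..t N}"
  using assms
proof (induction N)
  case (Suc N)
  then have "t 0 \<le> t N" "(f has_integral (\<Sum>k<N. I k)) {t 0..t N}" by auto
  moreover have "t N \<le> t (Suc N)" "(f has_integral I N) {t N..t (Suc N)}" using Suc.prems by auto
  ultimately show ?case
    using has_integral_combine[of "t 0" "t N" "t (Suc N)" f] by simp
qed (use has_integral_refl(2)[of f "t 0"] in auto)

text \<open>The modulus of continuity in the position is uniform over the whole space and scales
  with the velocity, so that freezing the position costs a multiple of length. No sign or coercivity
  is imposed, which lets the area integrand qualify with either sign.\<close>

locale lagrangian =
  fixes G :: "'a::euclidean_space \<Rightarrow> 'a \<Rightarrow> real"
  assumes cont: "continuous_on UNIV (\<lambda>(p, q). G p q)"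
    and conv: "convex_on UNIV (G p)"
    and homog: "c > 0 \<Longrightarrow> G p (c *\<^sub>R q) = c * G p q"
    and modulus: "e > 0 \<Longrightarrow> \<exists>d>0. \<forall>p p' q. norm (p - p') < d \<longrightarrow> \<bar>G p q - G p' q\<bar> \<le> e * norm q"
begin

lemma zero [simp]: "G p 0 = 0"
  using homog[of 2 p 0] by simp

text \<open>By homogeneity a bound for unit velocities is enough, and these together with positions
  in \<open>K\<close> form a compact set.\<close>

lemma linear_growth:
  assumes "compact K"
  obtains C where "C \<ge> 0" "\<And>p q. p \<in> K \<Longrightarrow> \<bar>G p q\<bar> \<le> C * norm q"
proof -
  define S where "S = (\<lambda>(p, q). G p q) ` (K \<times> sphere 0 1)"
  have "compact S"
    unfolding S_def
    using assms by (intro compact_continuous_image continuous_on_subset[OF cont] compact_Times) auto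
  then have "bounded S" by (rule compact_imp_bounded)
  then obtain C where "\<forall>y\<in>S. norm y \<le> C" unfolding bounded_iff ..
  moreover have "G p q \<in> S" if "p \<in> K" "norm q = 1" for p q
    using imageI[of "(p, q)" "K \<times> sphere 0 1" "\<lambda>(p, q). G p q"] that by (simp add: S_def)
  ultimately have C: "\<bar>G p q\<bar> \<le> C" if "p \<in> K" "norm q = 1" for p q
    using that by fastforce
  have "\<bar>G p q\<bar> \<le> max C 0 * norm q" if "p \<in> K" for p q
  proof (cases "q = 0")
    case False
    then have "G p q = norm q * G p (q /\<^sub>R norm q)"
      using homog[of "norm q" p "q /\<^sub>R norm q"] by simp
    then have "\<bar>G p q\<bar> = norm q * \<bar>G p (q /\<^sub>R norm q)\<bar>" by (simp add: abs_mult)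
    also have "\<dots> \<le> norm q * max C 0"
      using C[OF that, of "q /\<^sub>R norm q"] False by (intro mult_left_mono) auto
    finally show ?thesis by (simp add: mult.commute)
  qed simp
  then show thesis using that[of "max C 0"] by simp
qed

lemma absolutely_integrable:
  assumes "continuous_on {a..b} u" "v absolutely_integrable_on {a..b::real}"
  shows "(\<lambda>t. G (u t) (v t)) absolutely_integrable_on {a..b}"
proof -
  obtain C where C: "\<And>p q. p \<in> u ` {a..b} \<Longrightarrow> \<bar>G p q\<bar> \<le> C * norm q"
    using linear_growth[OF compact_continuous_image[OF assms(1) compact_Icc]] by metis
  have "u \<in> borel_measurable (lebesgue_on {a..b})"
    by (intro continuous_imp_measurable_on_sets_lebesgue assms) auto
  moreover have "v \<in> borel_measurable (lebesgue_on {a..b})"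
    using assms by (simp add: absolutely_integrable_measurable)
  ultimately have meas: "(\<lambda>t. G (u t) (v t)) \<in> borel_measurable (lebesgue_on {a..b})"
    using borel_measurable_continuous_on[OF cont, of "\<lambda>t. (u t, v t)" "lebesgue_on {a..b}"] by simp
  have "(\<lambda>t. C * norm (v t)) integrable_on {a..b}"
    using assms(2) by (auto simp: absolutely_integrable_on_def intro: integrable_on_mult_right)
  then show ?thesis
    by (intro measurable_bounded_by_integrable_imp_absolutely_integrable[OF meas]) (use C in auto)
qed

lemma absolutely_integrable_fixed:
  assumes "v absolutely_integrable_on {a..b::real}"
  shows "(\<lambda>t. G p (v t)) absolutely_integrable_on {a..b}"
  using absolutely_integrable[of a b "\<lambda>_. p"] assms by simp

text \<open>The epigraph of G p is a closed convex cone, so a half-space separating it from a point can be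
  chosen with the origin on its boundary, and its inequality can be integrated.\<close>

lemma jensen:
  assumes "(v has_integral x) {a..b::real}" "((\<lambda>t. G p (v t)) has_integral y) {a..b}"
  shows "G p x \<le> y"
proof (rule ccontr)
  assume "\<not> G p x \<le> y"
  then have "(x, y) \<notin> epigraph UNIV (G p)" by (simp add: epigraph_def)
  moreover have "convex (epigraph UNIV (G p))"
    using conv by (simp add: convex_epigraph)
  moreover have "closed (epigraph UNIV (G p))"
  proof -
    have "continuous_on UNIV (\<lambda>z. (\<lambda>(p, q). G p q) (p, fst z))"
      by (rule continuous_on_compose2[OF cont]) (auto intro!: continuous_intros)
    then have "closed {z :: 'a \<times> real. G p (fst z) \<le> snd z}"
      by (intro closed_Collect_le continuous_intros) simp
    then show ?thesis by (simp add: epigraph_def)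
  qed
  ultimately obtain z c where sep: "z \<bullet> (x, y) < c" "\<And>w. w \<in> epigraph UNIV (G p) \<Longrightarrow> c < z \<bullet> w"
    using separating_hyperplane_closed_point[of "epigraph UNIV (G p)" "(x, y)"] by blast
  obtain \<alpha> \<beta> where z: "z = (\<alpha>, \<beta>)" by (cases z)
  have sep': "c < \<alpha> \<bullet> q + \<beta> * G p q" for q
    using sep(2)[of "(q, G p q)"] by (simp add: epigraph_def z)
  \<comment> \<open>The origin lies in the epigraph because \<open>G p 0 = 0\<close>.\<close>
  have "c < 0" using sep'[of 0] by simp
  have nonneg: "0 \<le> \<alpha> \<bullet> q + \<beta> * G p q" for q
  proof (rule ccontr)
    define s where "s = \<alpha> \<bullet> q + \<beta> * G p q"
    assume "\<not> 0 \<le> \<alpha> \<bullet> q + \<beta> * G p q"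
    then have "s < 0" by (simp add: s_def)
    \<comment> \<open>Scaling \<open>q\<close> by \<open>c / s\<close> would bring the functional to
      exactly \<open>c\<close>, against the strict separation.\<close>
    have pos: "c / s > 0" using \<open>s < 0\<close> \<open>c < 0\<close> by (simp add: divide_neg_neg)
    have "c < \<alpha> \<bullet> ((c / s) *\<^sub>R q) + \<beta> * G p ((c / s) *\<^sub>R q)" by (rule sep')
    also have "\<dots> = (c / s) * (\<alpha> \<bullet> q + \<beta> * G p q)" by (simp add: homog[OF pos] distrib_left)
    also have "\<dots> = (c / s) * s" by (simp only: s_def)
    finally show False using \<open>s < 0\<close> by simp
  qed
  have "((\<lambda>t. \<alpha> \<bullet> v t + \<beta> * G p (v t)) has_integral (\<alpha> \<bullet> x + \<beta> * y)) {a..b}"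
    using has_integral_add[OF has_integral_linear[OF assms(1) bounded_linear_inner_right[of \<alpha>]]
        has_integral_mult_right[OF assms(2), of \<beta>]] by (simp add: o_def)
  then have "0 \<le> \<alpha> \<bullet> x + \<beta> * y"
    by (rule has_integral_nonneg) (use nonneg in auto)
  with sep(1) \<open>c < 0\<close> show False by (simp add: z)
qed

lemma polygon_sum_le:
  fixes u v :: "real \<Rightarrow> 'a" and t :: "nat \<Rightarrow> real"
  assumes mono: "\<And>k. k < N \<Longrightarrow> t k \<le> t (Suc k)"
    and v: "v absolutely_integrable_on {t 0..t N}"
    and u: "continuous_on {t 0..t N} u"
    and prim: "\<And>k. k < N \<Longrightarrow> (v has_integral (u (t (Suc k)) - u (t k))) {t k..t (Suc k)}"
    and close: "\<And>k s q. \<lbrakk>k < N; s \<in> {t k..t (Suc k)}\<rbrakk> \<Longrightarrow> \<bar>G (u (t k)) q - G (u s) q\<bar> \<le> e * norm q"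
  shows "(\<Sum>k<N. G (u (t k)) (u (t (Suc k)) - u (t k)))
     \<le> integral {t 0..t N} (\<lambda>s. G (u s) (v s)) + e * integral {t 0..t N} (\<lambda>s. norm (v s))"
proof -
  define f where "f s = G (u s) (v s) + e * norm (v s)" for s
  have mono': "t i \<le> t j" if "i \<le> j" "j \<le> N" for i j
    using that
  proof (induction j)
    case (Suc j)
    then show ?case using mono[of j] by (cases "i = Suc j") auto
  qed simp
  have sub: "{t k..t (Suc k)} \<subseteq> {t 0..t N}" if "k < N" for k
    using mono'[of 0 k] mono'[of "Suc k" N] that by auto
  have vk: "v absolutely_integrable_on {t k..t (Suc k)}" if "k < N" for k
    using set_integrable_subset[OF v _ sub[OF that]] by simp
  have intf: "(\<lambda>s. G (u s) (v s)) integrable_on {t 0..t N}" "(\<lambda>s. norm (v s)) integrable_on {t 0..t N}"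
    using absolutely_integrable[OF u v] v by (auto simp: absolutely_integrable_on_def)
  then have f: "f integrable_on {t 0..t N}"
    unfolding f_def by (intro integrable_add integrable_on_mult_right)
  have fk: "f integrable_on {t k..t (Suc k)}" if "k < N" for k
    using integrable_on_subinterval[OF f sub[OF that]] .
  have "G (u (t k)) (u (t (Suc k)) - u (t k)) \<le> integral {t k..t (Suc k)} f" if k: "k < N" for k
  proof -
    have i: "(\<lambda>s. G (u (t k)) (v s)) integrable_on {t k..t (Suc k)}"
      using absolutely_integrable_fixed[OF vk[OF k]] by (simp add: absolutely_integrable_on_def)
    then have "G (u (t k)) (u (t (Suc k)) - u (t k)) \<le> integral {t k..t (Suc k)} (\<lambda>s. G (u (t k)) (v s))"
      using jensen[OF prim[OF k]] by blast
    also have "\<dots> \<le> integral {t k..t (Suc k)} f"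
    proof (rule integral_le[OF i fk[OF k]])
      fix s assume "s \<in> {t k..t (Suc k)}"
      from close[OF k this, of "v s"] show "G (u (t k)) (v s) \<le> f s" by (simp add: f_def)
    qed
    finally show ?thesis .
  qed
  then have "(\<Sum>k<N. G (u (t k)) (u (t (Suc k)) - u (t k))) \<le> (\<Sum>k<N. integral {t k..t (Suc k)} f)"
    by (intro sum_mono) auto
  also have "\<dots> = integral {t 0..t N} f"
    using has_integral_sum_partition[of N t f "\<lambda>k. integral {t k..t (Suc k)} f",
        THEN conjunct2, THEN integral_unique] mono integrable_integral[OF fk] by presburger
  also have "\<dots> = integral {t 0..t N} (\<lambda>s. G (u s) (v s)) + e * integral {t 0..t N} (\<lambda>s. norm (v s))"
    unfolding f_def using intf by (simp add: integral_add integrable_on_mult_right)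
  finally show ?thesis .
qed

text \<open>Writing the sum as an integral makes it accessible to dominated convergence. On a cell
  the integrand is constant except at the right endpoint, where the floor jumps; homogeneity cancels
  the factor \<open>N\<close> against the cell length.\<close>

lemma step_function_has_integral:
  fixes W :: "real \<Rightarrow> 'a" and N :: nat
  assumes "N > 0"
  shows "((\<lambda>t. G (W (\<lfloor>N * t\<rfloor> / N)) (N *\<^sub>R (W ((\<lfloor>N * t\<rfloor> + 1) / N) - W (\<lfloor>N * t\<rfloor> / N))))
     has_integral (\<Sum>k<N. G (W (k / N)) (W (Suc k / N) - W (k / N)))) {0..1}"
proof -
  define f where "f t = G (W (\<lfloor>N * t\<rfloor> / N)) (N *\<^sub>R (W ((\<lfloor>N * t\<rfloor> + 1) / N) - W (\<lfloor>N * t\<rfloor> / N)))" for t :: real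
  define I where "I k = G (W (k / N)) (W (Suc k / N) - W (k / N))" for k :: nat
  have N: "real N > 0" using assms by simp
  have "(f has_integral I k) {k / N..Suc k / N}" for k
  proof (rule has_integral_spike_finite)
    show "finite {Suc k / real N}" by simp
    have "Suc k / N - k / N = 1 / N" by (simp add: diff_divide_distrib[symmetric])
    then have "measure lborel {k / N..Suc k / N} *\<^sub>R (real N * I k) = I k"
      using N by (simp add: divide_right_mono)
    then show "((\<lambda>t. real N * I k) has_integral I k) {k / N..Suc k / N}"
      using has_integral_const_real[of "real N * I k" "k / N" "Suc k / N"] by metis
    fix t assume "t \<in> {k / N..Suc k / N} - {Suc k / real N}"
    then have "real k \<le> N * t" "N * t < real k + 1" using N by (auto simp: field_simps)
    then have "\<lfloor>N * t\<rfloor> = int k" by linarith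
    then show "f t = real N * I k" using homog[OF N] by (simp add: f_def I_def add.commute)
  qed
  moreover have "k / N \<le> Suc k / N" for k using N by (simp add: divide_right_mono)
  ultimately show ?thesis
    using has_integral_sum_partition[of N "\<lambda>k. k / N" f I] N by (simp add: f_def[abs_def] I_def)
qed

text \<open>The difference quotient over the cell containing \<open>t\<close> converges to
  \<open>D t\<close> wherever \<open>W\<close> is differentiable, and the Lipschitz bound supplies
  the constant dominating function \<open>C * L\<close>.\<close>

theorem polygon_sum_tendsto:
  fixes W D :: "real \<Rightarrow> 'a"
  assumes lip: "L-lipschitz_on UNIV W" and E: "negligible E"
    and deriv: "\<And>t. t \<in> {0<..<1} - E \<Longrightarrow> (W has_vector_derivative D t) (at t)"
  shows "(\<lambda>N. \<Sum>k<N. G (W (k / N)) (W (Suc k / N) - W (k / N))) \<longlonglongrightarrow> integral {0..1} (\<lambda>t. G (W t) (D t))"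
proof -
  define l where "l N t = \<lfloor>real N * t\<rfloor> / real N" for N t
  define r where "r N t = (\<lfloor>real N * t\<rfloor> + 1) / real N" for N t
  define f where "f N t = G (W (l N t)) (real N *\<^sub>R (W (r N t) - W (l N t)))" for N t
  define S where "S = {0<..<1} - E"
  \<comment> \<open>Integrals over \<open>{0..1}\<close> and over \<open>S\<close> agree. Working on
    \<open>S\<close> gives the convergence at every point, as the dominated convergence theorem
    requires.\<close>
  have "negligible {x \<in> S - {0..1}. h x \<noteq> 0}" "negligible {x \<in> {0..1} - S. h x \<noteq> 0}"
    for h :: "real \<Rightarrow> real"
    by (rule negligible_subset[of "E \<union> {0,1}"]; use E in \<open>auto simp: S_def\<close>)+
  note spike = has_integral_spike_set_eq[OF this]
  have lr: "l N t \<le> t" "t < r N t" "r N t - l N t = 1 / N" if "N > 0" for N t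
  proof -
    have N: "real N > 0" using that by simp
    have "\<lfloor>real N * t\<rfloor> \<le> real N * t" "real N * t < \<lfloor>real N * t\<rfloor> + 1" by linarith+
    then show "l N t \<le> t" "t < r N t" 
      using N by (auto simp: l_def r_def pos_divide_le_eq pos_less_divide_eq mult.commute)
    show "r N t - l N t = 1 / N" by (simp add: l_def r_def diff_divide_distrib[symmetric])
  qed
  have "L \<ge> 0" using lip lipschitz_on_nonneg by blast
  have Wlip: "norm (W x - W y) \<le> L * \<bar>x - y\<bar>" for x y
    using lipschitz_onD[OF lip, of x y] by (simp add: dist_norm dist_real_def)
  have contW: "continuous_on UNIV W" using lip by (rule lipschitz_on_continuous_on)
  obtain C where "C \<ge> 0" and C: "\<And>p q. p \<in> W ` {0..1} \<Longrightarrow> \<bar>G p q\<bar> \<le> C * norm q"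
    by (rule linear_growth[OF compact_continuous_image[OF continuous_on_subset[OF contW subset_UNIV] compact_Icc[of 0 1]]])
      (use that in blast)
  have fint: "(f N has_integral (\<Sum>k<N. G (W (k / N)) (W (Suc k / N) - W (k / N)))) S" if "N > 0" for N
    unfolding spike using step_function_has_integral[OF that, of W] by (simp add: f_def[abs_def] l_def r_def)
  \<comment> \<open>The index is shifted to \<open>Suc N\<close> to keep denominators positive; the
    shift is undone at the very end.\<close>
  have lim: "(\<lambda>N. f (Suc N) t) \<longlonglongrightarrow> G (W t) (D t)" if t: "t \<in> S" for t
  proof -
    have small: "\<bar>l (Suc N) t - t\<bar> \<le> inverse (Suc N)" "\<bar>r (Suc N) t - t\<bar> \<le> inverse (Suc N)" for N
      using lr[of "Suc N" t] by (auto simp: inverse_eq_divide)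
    have l: "(\<lambda>N. l (Suc N) t) \<longlonglongrightarrow> t"
    proof (rule LIM_zero_cancel, rule Lim_null_comparison[OF _ LIMSEQ_inverse_real_of_nat])
      show "\<forall>\<^sub>F N in sequentially. norm (l (Suc N) t - t) \<le> inverse (real (Suc N))"
        using small(1) by (intro always_eventually allI) (simp only: real_norm_def)
    qed
    have Wl: "(\<lambda>N. W (l (Suc N) t)) \<longlonglongrightarrow> W t"
      by (rule continuous_on_tendsto_compose[OF contW l]) auto
    \<comment> \<open>The cell surrounds \<open>t\<close> instead of starting there. Its quotient
      differs from \<open>D t\<close> by two remainders, at the left and right ends, each at most
      \<open>e/2\<close> times the distance to \<open>t\<close>; these distances add up to the cell
      length.\<close>
    have Dl: "(\<lambda>N. real (Suc N) *\<^sub>R (W (r (Suc N) t) - W (l (Suc N) t))) \<longlonglongrightarrow> D t"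
    proof (rule LIMSEQ_I)
      fix e :: real assume "e > 0"
      have "(W has_vector_derivative D t) (at t)" using deriv t by (simp add: S_def)
      then have "\<forall>e>0. \<exists>d>0. \<forall>y\<in>UNIV. norm (y - t) < d \<longrightarrow>
          norm (W y - W t - (y - t) *\<^sub>R D t) \<le> e * norm (y - t)"
        unfolding has_vector_derivative_def has_derivative_within_alt by blast
      from this[rule_format, OF half_gt_zero[OF \<open>e > 0\<close>]]
      obtain d where "d > 0" and d: "\<And>y. \<bar>y - t\<bar> < d \<Longrightarrow> norm (W y - W t - (y - t) *\<^sub>R D t) \<le> e/2 * \<bar>y - t\<bar>"
        by auto
      obtain n0 where n0: "inverse (real (Suc n0)) < d" using \<open>d > 0\<close> reals_Archimedean by blast
      have "norm (real (Suc N) *\<^sub>R (W (r (Suc N) t) - W (l (Suc N) t)) - D t) < e" if "N \<ge> n0" for N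
      proof -
        define n where "n = real (Suc N)"
        define a b where "a = l (Suc N) t" and "b = r (Suc N) t"
        have n: "n > 0" by (simp add: n_def)
        have ab: "a \<le> t" "t < b" "n * (b - a) = 1"
          using lr[of "Suc N" t] by (auto simp: a_def b_def n_def)
        have "inverse n \<le> inverse (real (Suc n0))"
          using that by (simp add: n_def)
        then have "inverse (real (Suc N)) < d" unfolding n_def using n0 by linarith
        then have "\<bar>a - t\<bar> < d" "\<bar>b - t\<bar> < d"
          using small[of N] unfolding a_def b_def by linarith+
        note dab = d[OF this(1)] d[OF this(2)]
        have "n *\<^sub>R (W b - W a) - D t = n *\<^sub>R (W b - W a) - (n * (b - a)) *\<^sub>R D t"
          using ab by simp
        also have "\<dots> = n *\<^sub>R ((W b - W t - (b - t) *\<^sub>R D t) - (W a - W t - (a - t) *\<^sub>R D t))"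
          by (simp add: algebra_simps)
        finally have "norm (n *\<^sub>R (W b - W a) - D t)
            = n * norm ((W b - W t - (b - t) *\<^sub>R D t) - (W a - W t - (a - t) *\<^sub>R D t))"
          using n by simp
        also have "\<dots> \<le> n * (e/2 * \<bar>b - t\<bar> + e/2 * \<bar>a - t\<bar>)"
          using n dab by (intro mult_left_mono order_trans[OF norm_triangle_ineq4]) auto
        also have "e/2 * \<bar>b - t\<bar> + e/2 * \<bar>a - t\<bar> = e/2 * (b - a)"
          using ab by (simp add: field_simps)
        also have "n * (e/2 * (b - a)) = e/2 * (n * (b - a))" by (rule mult.left_commute)
        also have "\<dots> < e" using ab \<open>e > 0\<close> by simp
        finally show ?thesis by (simp add: n_def a_def b_def)
      qed
      then show "\<exists>no. \<forall>N\<ge>no. norm (real (Suc N) *\<^sub>R (W (r (Suc N) t) - W (l (Suc N) t)) - D t) < e"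
        by blast
    qed
    have "isCont (\<lambda>(p, q). G p q) (W t, D t)"
      using cont by (simp add: continuous_on_eq_continuous_at)
    from isCont_tendsto_compose[OF this tendsto_Pair[OF Wl Dl]] show ?thesis
      by (simp add: f_def)
  qed
  have "(\<lambda>N. integral S (f (Suc N))) \<longlonglongrightarrow> integral S (\<lambda>t. G (W t) (D t))"
  proof (rule dominated_convergence(2)[OF _ _ _ lim])
    show "f (Suc N) integrable_on S" for N using fint[of "Suc N"] by blast
    show "(\<lambda>_. C * L) integrable_on S"
      unfolding integrable_on_def spike using integrable_const_ivl[of "C * L" 0 1]
      by (simp add: integrable_on_def)
    fix N t assume t: "t \<in> S"
    let ?N = "Suc N"
    have "l ?N t \<ge> 0" using t by (auto simp: l_def S_def)
    then have "l ?N t \<in> {0..1}" using lr(1)[of ?N t] t by (auto simp: S_def)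
    then have "norm (f ?N t) \<le> C * norm (real ?N *\<^sub>R (W (r ?N t) - W (l ?N t)))"
      unfolding f_def real_norm_def by (intro C imageI)
    also have "\<dots> \<le> C * L"
    proof (rule mult_left_mono[OF _ \<open>C \<ge> 0\<close>])
      have "norm (real ?N *\<^sub>R (W (r ?N t) - W (l ?N t))) \<le> real ?N * (L * \<bar>r ?N t - l ?N t\<bar>)"
        unfolding norm_scaleR using Wlip by (intro mult_mono) auto
      also have "\<dots> = L" using lr(3)[of ?N t] by simp
      finally show "norm (real ?N *\<^sub>R (W (r ?N t) - W (l ?N t))) \<le> L" .
    qed
    finally show "norm (f ?N t) \<le> C * L" .
  qed
  moreover have "integral S (f (Suc N)) = (\<Sum>k<Suc N. G (W (k / Suc N)) (W (Suc k / Suc N) - W (k / Suc N)))" for N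
    by (rule integral_unique[OF fint]) simp
  moreover have "integral S (\<lambda>t. G (W t) (D t)) = integral {0..1} (\<lambda>t. G (W t) (D t))"
    by (simp add: integral_def integrable_on_def spike)
  ultimately have "(\<lambda>N. \<Sum>k<Suc N. G (W (k / Suc N)) (W (Suc k / Suc N) - W (k / Suc N)))
      \<longlonglongrightarrow> integral {0..1} (\<lambda>t. G (W t) (D t))"
    by (simp only:)
  then show ?thesis by (rule filterlim_sequentially_Suc[THEN iffD1])
qed

end

section \<open>Compactness of closed curves of bounded length\<close>

text \<open>Adding the parameter to the arclength makes it strictly increasing, hence invertible, even where
  the curve is stationary.\<close>

lemma arclength_reparametrization:
  fixes v :: "real \<Rightarrow> 'a::euclidean_space"
  assumes v: "v absolutely_integrable_on {0..1}"
  defines "K \<equiv> integral {0..1} (\<lambda>s. norm (v s)) + 1"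
  obtains \<gamma> :: "real \<Rightarrow> real" where "\<gamma> 0 = 0" "\<gamma> 1 = 1"
    "\<And>a b. \<lbrakk>0 \<le> a; a \<le> b; b \<le> 1\<rbrakk> \<Longrightarrow> \<gamma> a \<le> \<gamma> b"
    "\<And>a b. \<lbrakk>0 \<le> a; a \<le> b; b \<le> 1\<rbrakk> \<Longrightarrow> integral {\<gamma> a..\<gamma> b} (\<lambda>s. norm (v s)) \<le> K * (b - a)"
proof -
  define l where "l t = integral {0..t} (\<lambda>s. norm (v s))" for t
  define s where "s t = l t + t" for t
  have int: "(\<lambda>s. norm (v s)) integrable_on {0..1}"
    using v by (simp add: absolutely_integrable_on_def)
  have l_diff: "l b - l a = integral {a..b} (\<lambda>s. norm (v s))" if "0 \<le> a" "a \<le> b" "b \<le> 1" for a b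
  proof -
    have "(\<lambda>s. norm (v s)) integrable_on {0..b}"
      using integrable_on_subinterval[OF int, of 0 b] that by auto
    then show ?thesis
      using Henstock_Kurzweil_Integration.integral_combine[OF that(1,2), of "\<lambda>s. norm (v s)"] by (simp add: l_def)
  qed
  have l_mono: "l a \<le> l b" if "0 \<le> a" "a \<le> b" "b \<le> 1" for a b
    using l_diff[OF that] integral_nonneg[OF integrable_on_subinterval[OF int, of a b]] that by auto
  have s_le: "s a \<le> s b \<longleftrightarrow> a \<le> b" if "a \<in> {0..1}" "b \<in> {0..1}" for a b
    using l_mono[of a b] l_mono[of b a] that
    by (cases a b rule: linorder_cases) (auto simp: s_def)
  have s01: "s 0 = 0" "s 1 = K" by (simp_all add: s_def l_def K_def)
  have "K > 0" using l_mono[of 0 1] by (simp add: K_def l_def)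
  have "continuous_on {0..1} s"
    unfolding s_def l_def by (intro continuous_intros indefinite_integral_continuous_1 int)
  \<comment> \<open>\<open>s\<close> runs continuously from 0 to \<open>K\<close>, so
    \<open>\<gamma>\<close> can be chosen by the intermediate value theorem as the inverse of
    \<open>s / K\<close>.\<close>
  then have "\<exists>t\<in>{0..1}. s t = \<sigma> * K" if "\<sigma> \<in> {0..1}" for \<sigma>
    using IVT'[of s 0 "\<sigma> * K" 1] that s01 \<open>K > 0\<close> by (auto simp: mult_le_cancel_right2)
  then obtain \<gamma> where \<gamma>: "\<And>\<sigma>. \<sigma> \<in> {0..1} \<Longrightarrow> \<gamma> \<sigma> \<in> {0..1}" "\<And>\<sigma>. \<sigma> \<in> {0..1} \<Longrightarrow> s (\<gamma> \<sigma>) = \<sigma> * K"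
    by metis
  show thesis
  proof
    have inj: "x = y" if "x \<in> {0..1}" "y \<in> {0..1}" "s x = s y" for x y
      using s_le[of x y] s_le[of y x] that by auto
    show "\<gamma> 0 = 0" "\<gamma> 1 = 1"
      using inj[of "\<gamma> 0" 0] inj[of "\<gamma> 1" 1] \<gamma>[of 0] \<gamma>[of 1] s01 by auto
    fix a b :: real assume ab: "0 \<le> a" "a \<le> b" "b \<le> 1"
    have \<gamma>ab: "\<gamma> a \<in> {0..1}" "\<gamma> b \<in> {0..1}" "s (\<gamma> a) = a * K" "s (\<gamma> b) = b * K"
      using \<gamma>[of a] \<gamma>[of b] ab by auto
    have "a * K \<le> b * K" using ab \<open>K > 0\<close> by (simp add: mult_right_mono)
    then show le: "\<gamma> a \<le> \<gamma> b" using s_le[of "\<gamma> a" "\<gamma> b"] \<gamma>ab by simp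
    have "integral {\<gamma> a..\<gamma> b} (\<lambda>s. norm (v s)) = l (\<gamma> b) - l (\<gamma> a)"
      using l_diff[of "\<gamma> a" "\<gamma> b"] \<gamma>ab le by simp
    also have "\<dots> \<le> s (\<gamma> b) - s (\<gamma> a)" using le by (simp add: s_def)
    also have "\<dots> = K * (b - a)" using \<gamma>ab by (simp add: algebra_simps)
    finally show "integral {\<gamma> a..\<gamma> b} (\<lambda>s. norm (v s)) \<le> K * (b - a)" .
  qed
qed

lemma norm_increment_le:
  fixes v :: "real \<Rightarrow> 'a::euclidean_space"
  assumes "v absolutely_integrable_on {a..b}" "(v has_integral (u b - u a)) {a..b}"
  shows "norm (u b - u a) \<le> integral {a..b} (\<lambda>s. norm (v s))"
  using integral_norm_bound_integral[of v "{a..b}" "\<lambda>s. norm (v s)"] assms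
  by (auto simp: absolutely_integrable_on_def integral_unique)

lemma continuous_on_primitive:
  fixes u v :: "real \<Rightarrow> 'a::euclidean_space"
  assumes "\<And>t. t \<in> {a..b} \<Longrightarrow> (v has_integral (u t - u a)) {a..t}"
  shows "continuous_on {a..b} u"
proof (cases "a \<le> b")
  case True
  then have "continuous_on {a..b} (\<lambda>x. integral {a..x} v + u a)"
    using assms[of b] by (intro continuous_intros indefinite_integral_continuous_1) auto
  then show ?thesis
    by (rule continuous_on_eq) (use integral_unique[OF assms] in auto)
qed simp

text \<open>The points \<open>\<gamma> (k / N)\<close> serve as a partition for the original
  parameter, so \<open>\<gamma>\<close> never enters an integrand. Each piece has length at most
  \<open>K / N < d\<close>, hence the position moves by less than \<open>d\<close> on it and the
  modulus yields the error factor \<open>e\<close>.\<close>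

lemma (in lagrangian) reparametrized_polygon_sum_le:
  fixes u v :: "real \<Rightarrow> 'a" and \<gamma> :: "real \<Rightarrow> real"
  assumes v: "v absolutely_integrable_on {0..1}"
    and prim: "\<And>a b. \<lbrakk>0 \<le> a; a \<le> b; b \<le> 1\<rbrakk> \<Longrightarrow> (v has_integral (u b - u a)) {a..b}"
    and \<gamma>01: "\<gamma> 0 = 0" "\<gamma> 1 = 1"
    and mono: "\<And>a b. \<lbrakk>0 \<le> a; a \<le> b; b \<le> 1\<rbrakk> \<Longrightarrow> \<gamma> a \<le> \<gamma> b"
    and len: "\<And>a b. \<lbrakk>0 \<le> a; a \<le> b; b \<le> 1\<rbrakk> \<Longrightarrow> integral {\<gamma> a..\<gamma> b} (\<lambda>s. norm (v s)) \<le> K * (b - a)"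
    and close: "\<And>p p' q. norm (p - p') < d \<Longrightarrow> \<bar>G p q - G p' q\<bar> \<le> e * norm q"
    and N: "N > 0" "K / real N < d"
  shows "(\<Sum>k<N. G (u (\<gamma> (k / N))) (u (\<gamma> (Suc k / N)) - u (\<gamma> (k / N))))
     \<le> integral {0..1} (\<lambda>s. G (u s) (v s)) + e * integral {0..1} (\<lambda>s. norm (v s))"
proof -
  define t where "t k = \<gamma> (real k / N)" for k
  have t0N: "t 0 = 0" "t N = 1" using \<gamma>01 N by (simp_all add: t_def)
  have t_range: "0 \<le> t k" "t k \<le> 1" if "k \<le> N" for k
    using mono[of 0 "k / N"] mono[of "k / N" 1] that N by (auto simp: \<gamma>01 t_def)
  have t_mono: "t k \<le> t (Suc k)" if "k < N" for k
    using mono[of "k / N" "Suc k / N"] that N by (auto simp: t_def divide_right_mono)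
  have vsub: "v absolutely_integrable_on {a..b}" if "0 \<le> a" "b \<le> 1" for a b
    using set_integrable_subset[OF v, of "{a..b}"] that by simp
  have contu: "continuous_on {0..1} u"
    using prim by (intro continuous_on_primitive) auto
  have "(\<Sum>k<N. G (u (t k)) (u (t (Suc k)) - u (t k)))
     \<le> integral {t 0..t N} (\<lambda>s. G (u s) (v s)) + e * integral {t 0..t N} (\<lambda>s. norm (v s))"
  proof (rule polygon_sum_le)
    fix k assume k: "k < N"
    show "t k \<le> t (Suc k)" using t_mono[OF k] .
    show "(v has_integral (u (t (Suc k)) - u (t k))) {t k..t (Suc k)}"
      using prim t_range[of k] t_range[of "Suc k"] t_mono[OF k] k by auto
  next
    fix k s q assume k: "k < N" and s: "s \<in> {t k..t (Suc k)}"
    have r: "0 \<le> t k" "t k \<le> s" "s \<le> t (Suc k)" "t (Suc k) \<le> 1"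
      using t_range[of k] t_range[of "Suc k"] s k by auto
    have "norm (u s - u (t k)) \<le> integral {t k..s} (\<lambda>s. norm (v s))"
      using r by (intro norm_increment_le vsub prim) auto
    also have "\<dots> \<le> integral {t k..t (Suc k)} (\<lambda>s. norm (v s))"
      using r vsub[of "t k" s] vsub[of "t k" "t (Suc k)"]
      by (intro integral_subset_le) (auto simp: absolutely_integrable_on_def)
    also have "\<dots> \<le> K * (Suc k / N - k / N)"
      unfolding t_def using k N by (intro len) (auto simp: divide_right_mono)
    also have "Suc k / N - k / N = 1 / N" by (simp add: diff_divide_distrib[symmetric])
    finally have "norm (u (t k) - u s) < d" using N by (simp add: norm_minus_commute)
    then show "\<bar>G (u (t k)) q - G (u s) q\<bar> \<le> e * norm q" by (rule close)
  qed (simp_all add: t0N v contu)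
  then show ?thesis unfolding t0N by (simp add: t_def)
qed

text \<open>Replaces \<open>vector_derivative\<close> by a weak derivative \<open>v\<close>, equal
  to it almost everywhere on the unit interval. One \<open>v\<close> serves all integrands, so
  energy, area and length can be compared under the integral sign.\<close>

lemma W11per_derivative:
  assumes "u \<in> W11per"
  obtains v where "v absolutely_integrable_on {0..1}"
    "\<And>a b. a \<le> b \<Longrightarrow> (v has_integral (u b - u a)) {a..b}"
    "\<And>G. Fcal G u = integral {0..1} (\<lambda>t. G (u t) (v t))"
proof -
  obtain v where v: "\<And>a b. a \<le> b \<Longrightarrow> v absolutely_integrable_on {a..b}"
      "\<And>a b. a \<le> b \<Longrightarrow> (v has_integral (u b - u a)) {a..b}"
    using assms by (auto simp: W11per_def W11loc_def)
  obtain E where E: "negligible E" "\<And>t. t \<in> {0<..<1} - E \<Longrightarrow> (u has_vector_derivative v t) (at t)"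
    by (rule has_vector_derivative_indefinite_integral_ae[of 0 1 v u]) (use v in auto)
  have "Fcal G u = integral {0..1} (\<lambda>t. G (u t) (v t))" for G
    unfolding Fcal_def
  proof (rule integral_spike[of "E \<union> {0,1}"])
    show "negligible (E \<union> {0,1})" using E by simp
    fix t :: real assume "t \<in> {0..1} - (E \<union> {0,1})"
    then have "t \<in> {0<..<1} - E" by auto
    then show "G (u t) (v t) = G (u t) (vector_derivative u (at t))"
      using vector_derivative_at[OF E(2)] by metis
  qed
  with that[of v] v show thesis by simp
qed

text \<open>When \<open>x\<close> and \<open>y\<close> lie in different periods, the values are
  joined through the common value \<open>g 0 = g 1\<close>: the rest of the first period and the
  initial part of the last together are no longer than \<open>y - x\<close>.\<close>

lemma lipschitz_periodic_extension:
  fixes g :: "real \<Rightarrow> 'a::metric_space"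
  assumes g: "K-lipschitz_on {0..1} g" and "g 0 = g 1"
  shows "K-lipschitz_on UNIV (\<lambda>t. g (frac t))"
proof (rule lipschitz_on_leI)
  show "0 \<le> K" using g by (rule lipschitz_on_nonneg)
  fix x y :: real assume "x \<le> y"
  have frac01: "frac t \<in> {0..1}" for t :: real
    using frac_ge_0[of t] frac_lt_1[of t] by auto
  show "dist (g (frac x)) (g (frac y)) \<le> K * dist x y"
  proof (cases "\<lfloor>x\<rfloor> = \<lfloor>y\<rfloor>")
    case True
    then have "dist (frac x) (frac y) = dist x y" by (simp add: frac_def dist_real_def)
    then show ?thesis using lipschitz_onD[OF g frac01 frac01, of x y] by simp
  next
    case False
    then have "\<lfloor>x\<rfloor> + 1 \<le> \<lfloor>y\<rfloor>" using floor_mono[OF \<open>x \<le> y\<close>] by linarith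
    then have "(1 - frac x) + frac y \<le> y - x" unfolding frac_def by linarith
    moreover have "dist (g (frac x)) (g 1) \<le> K * (1 - frac x)" "dist (g 0) (g (frac y)) \<le> K * frac y"
      using lipschitz_onD[OF g frac01[of x], of 1] lipschitz_onD[OF g _ frac01[of y], of 0] frac01[of x] frac01[of y]
      by (auto simp: dist_real_def)
    moreover have "dist (g (frac x)) (g (frac y)) \<le> dist (g (frac x)) (g 1) + dist (g 0) (g (frac y))"
      using \<open>g 0 = g 1\<close> dist_triangle by metis
    ultimately have "dist (g (frac x)) (g (frac y)) \<le> K * ((1 - frac x) + frac y)"
      by (simp add: distrib_left)
    also have "\<dots> \<le> K * (y - x)" using \<open>0 \<le> K\<close> \<open>_ \<le> y - x\<close> by (rule mult_left_mono[rotated])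
    finally show ?thesis using \<open>x \<le> y\<close> by (simp add: dist_real_def)
  qed
qed

text \<open>Applied to both G and -G the last property gives convergence of the integrals; this is how the
  area constraint passes to the limit.\<close>

theorem closed_curve_compactness:
  fixes u :: "nat \<Rightarrow> real \<Rightarrow> complex"
  assumes u: "\<And>n. u n \<in> W11per"
    and length: "\<And>n. Fcal (\<lambda>p q. cmod q) (u n) \<le> \<Lambda>"
    and base: "\<And>n. cmod (u n 0) \<le> B"
  obtains W L k where "strict_mono (k :: nat \<Rightarrow> nat)" "L-lipschitz_on UNIV W" "W \<in> W11per"
    "\<And>G c. \<lbrakk>lagrangian G; (\<lambda>n. Fcal G (u (k n))) \<longlonglongrightarrow> c\<rbrakk> \<Longrightarrow> Fcal G W \<le> c"
proof -
  have "\<exists>v. v absolutely_integrable_on {0..1} \<and>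
    (\<forall>a b. a \<le> b \<longrightarrow> (v has_integral (u n b - u n a)) {a..b}) \<and>
    (\<forall>G. Fcal G (u n) = integral {0..1} (\<lambda>t. G (u n t) (v t)))" for n
    by (rule W11per_derivative[OF u[of n]]) blast
  then obtain v where v: "\<And>n. v n absolutely_integrable_on {0..1}"
    and prim: "\<And>n a b. a \<le> b \<Longrightarrow> (v n has_integral (u n b - u n a)) {a..b}"
    and Fcal: "\<And>n G. Fcal G (u n) = integral {0..1} (\<lambda>t. G (u n t) (v n t))"
    by metis
  define l where "l n = integral {0..1} (\<lambda>t. norm (v n t))" for n
  have l: "l n \<le> \<Lambda>" for n using length[of n] by (simp add: Fcal l_def)
  have l0: "0 \<le> l n" for n unfolding l_def
    using v[of n] by (intro integral_nonneg) (auto simp: absolutely_integrable_on_def)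
  have "\<exists>\<gamma>. \<gamma> 0 = 0 \<and> \<gamma> 1 = 1 \<and> (\<forall>a b. 0 \<le> a \<longrightarrow> a \<le> b \<longrightarrow> b \<le> 1 \<longrightarrow> \<gamma> a \<le> \<gamma> b \<and>
      integral {\<gamma> a..\<gamma> b} (\<lambda>s. norm (v n s)) \<le> (l n + 1) * (b - a))" for n
    unfolding l_def by (rule arclength_reparametrization[OF v[of n]]) blast
  then obtain \<gamma> where \<gamma>: "\<And>n. \<gamma> n 0 = 0" "\<And>n. \<gamma> n 1 = (1::real)"
    "\<And>n a b. \<lbrakk>0 \<le> a; a \<le> b; b \<le> 1\<rbrakk> \<Longrightarrow> \<gamma> n a \<le> \<gamma> n b"
    "\<And>n a b. \<lbrakk>0 \<le> a; a \<le> b; b \<le> 1\<rbrakk> \<Longrightarrow> integral {\<gamma> n a..\<gamma> n b} (\<lambda>s. norm (v n s)) \<le> (l n + 1) * (b - a)"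
    by metis
  define K where "K = \<Lambda> + 1"
  have "K > 0" using l0[of 0] l[of 0] by (simp add: K_def)
  \<comment> \<open>The constants \<open>l n + 1\<close> of the single curves are replaced by a
    common one, making the reparametrized curves equi-Lipschitz.\<close>
  have \<gamma>K: "integral {\<gamma> n a..\<gamma> n b} (\<lambda>s. norm (v n s)) \<le> K * (b - a)"
    if "0 \<le> a" "a \<le> b" "b \<le> 1" for n a b
    by (rule order_trans[OF \<gamma>(4)[OF that]]) (use l[of n] that in \<open>simp add: K_def mult_right_mono\<close>)
  define w where "w n t = u n (\<gamma> n t)" for n t
  have w_lip: "K-lipschitz_on {0..1} (w n)" for n
  proof (rule lipschitz_on_leI)
    fix x y :: real assume xy: "x \<in> {0..1}" "y \<in> {0..1}" "x \<le> y"
    have r: "0 \<le> \<gamma> n x" "\<gamma> n x \<le> \<gamma> n y" "\<gamma> n y \<le> 1"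
      using \<gamma>(3)[of 0 x n] \<gamma>(3)[of x y n] \<gamma>(3)[of y 1 n] xy by (auto simp: \<gamma>(1,2))
    have "v n absolutely_integrable_on {\<gamma> n x..\<gamma> n y}"
      using set_integrable_subset[OF v[of n], of "{\<gamma> n x..\<gamma> n y}"] r by simp
    then have "norm (w n y - w n x) \<le> integral {\<gamma> n x..\<gamma> n y} (\<lambda>s. norm (v n s))"
      unfolding w_def by (rule norm_increment_le) (rule prim[OF r(2)])
    also have "\<dots> \<le> K * (y - x)" using \<gamma>K xy by simp
    finally show "dist (w n x) (w n y) \<le> K * dist x y"
      using xy by (simp add: dist_norm norm_minus_commute)
  qed (use \<open>K > 0\<close> in simp)
  have w_bound: "norm (w n t) \<le> B + K" if "t \<in> {0..1}" for n t
  proof -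
    have "norm (w n t - w n 0) \<le> K * t"
      using lipschitz_onD[OF w_lip, of t 0 n] that by (simp add: dist_norm)
    also have "\<dots> \<le> K" using that \<open>K > 0\<close> by (simp add: mult_le_cancel_left2)
    finally have "norm (w n t - w n 0) \<le> K" .
    moreover have "norm (w n 0) \<le> B" using base[of n] by (simp add: w_def \<gamma>(1))
    ultimately show ?thesis using norm_triangle_ineq2[of "w n t" "w n 0"] by linarith
  qed
  obtain g k where k: "strict_mono (k :: nat \<Rightarrow> nat)"
    and unif: "\<And>e. 0 < e \<Longrightarrow> \<exists>N. \<forall>n x. n \<ge> N \<and> x \<in> {0..1} \<longrightarrow> norm (w (k n) x - g x) < e"
  proof (rule Arzela_Ascoli[of "{0..1::real}" w "B + K"])
    fix x e :: real assume xe: "x \<in> {0..1}" "0 < e"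
    show "\<exists>d>0. \<forall>n y. y \<in> {0..1} \<and> norm (x - y) < d \<longrightarrow> norm (w n x - w n y) < e"
    proof (intro exI conjI allI impI)
      show "e / K > 0" using xe \<open>K > 0\<close> by simp
      fix n y assume y: "y \<in> {0..1} \<and> norm (x - y) < e / K"
      then have "norm (w n x - w n y) \<le> K * norm (x - y)"
        using lipschitz_onD[OF w_lip, of x y n] xe by (simp add: dist_norm)
      also have "\<dots> < e" using y \<open>K > 0\<close> by (simp add: pos_less_divide_eq mult.commute)
      finally show "norm (w n x - w n y) < e" .
    qed
  qed (use w_bound in auto)
  have lim: "(\<lambda>n. w (k n) x) \<longlonglongrightarrow> g x" if "x \<in> {0..1}" for x
    by (rule LIMSEQ_I) (use unif that in blast)
  have g_lip: "K-lipschitz_on {0..1} g"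
  proof (rule lipschitz_onI)
    fix x y :: real assume xy: "x \<in> {0..1}" "y \<in> {0..1}"
    have "(\<lambda>n. dist (w (k n) x) (w (k n) y)) \<longlonglongrightarrow> dist (g x) (g y)"
      using xy by (intro tendsto_dist lim)
    then show "dist (g x) (g y) \<le> K * dist x y"
      by (rule LIMSEQ_le_const2) (use lipschitz_onD[OF w_lip] xy in blast)
  qed (use \<open>K > 0\<close> in simp)
  have "w n 0 = w n 1" for n
    using u[of n] unfolding w_def \<gamma> W11per_def by (metis (mono_tags, lifting) add_0 mem_Collect_eq)
  then have "g 0 = g 1"
    using lim[of 0] lim[of 1] by (simp add: LIMSEQ_unique)
  define W where "W t = g (frac t)" for t
  have W_lip: "K-lipschitz_on UNIV W"
    unfolding W_def using lipschitz_periodic_extension[OF g_lip \<open>g 0 = g 1\<close>] .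
  \<comment> \<open>Only \<open>t = 1\<close> needs the closing condition, since
    \<open>frac 1 = 0\<close>.\<close>
  have Wg: "W t = g t" if "t \<in> {0..1}" for t
  proof (cases "t = 1")
    case True then show ?thesis using \<open>g 0 = g 1\<close> by (simp add: W_def)
  next
    case False then show ?thesis using that by (simp add: W_def frac_eq)
  qed
  have "W11loc W"
    using lipschitz_has_weak_derivative[OF W_lip] unfolding W11loc_def by metis
  then have W: "W \<in> W11per" by (simp add: W11per_def W_def frac_1_eq)
  obtain D where D: "\<And>a b. a \<le> b \<Longrightarrow> (D has_integral (W b - W a)) {a..b}"
    and FcalW: "\<And>G. Fcal G W = integral {0..1} (\<lambda>t. G (W t) (D t))"
    by (rule W11per_derivative[OF W]) blast
  obtain E where E: "negligible E" "\<And>t. t \<in> {0<..<1} - E \<Longrightarrow> (W has_vector_derivative D t) (at t)"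
    by (rule has_vector_derivative_indefinite_integral_ae[of 0 1 D W]) (use D in auto)
  have "Fcal G W \<le> c" if "lagrangian G" and c: "(\<lambda>n. Fcal G (u (k n))) \<longlonglongrightarrow> c" for G c
  proof -
    interpret lagrangian G by fact
    have bound: "Fcal G W \<le> c + e * \<Lambda>" if "e > 0" for e
    proof -
      obtain d where "d > 0" and d: "\<And>p p' q. norm (p - p') < d \<Longrightarrow> \<bar>G p q - G p' q\<bar> \<le> e * norm q"
        using modulus[OF \<open>e > 0\<close>] by blast
      define P where "P f N = (\<Sum>j<N. G (f (j / N)) (f (Suc j / N) - f (j / N)))"
        for f :: "real \<Rightarrow> complex" and N :: nat
      \<comment> \<open>\<open>N\<close> stays fixed while the curves converge. How large it must be
        depends on \<open>K\<close> and \<open>d\<close> only, hence not on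
        \<open>n\<close>.\<close>
      have "P W N \<le> c + e * \<Lambda>" if N: "N > 0" "K / real N < d" for N
      proof -
        have in01: "real j / N \<in> {0..1}" if "j \<le> N" for j using that N by auto
        have "(\<lambda>n. P (w (k n)) N) \<longlonglongrightarrow> P g N"
          unfolding P_def
        proof (rule tendsto_sum)
          fix j assume "j \<in> {..<N}"
          then have "j \<le> N" "Suc j \<le> N" by auto
          note lim[OF in01[OF this(1)]] lim[OF in01[OF this(2)]]
          then have "(\<lambda>n. (w (k n) (j / N), w (k n) (Suc j / N) - w (k n) (j / N)))
              \<longlonglongrightarrow> (g (j / N), g (Suc j / N) - g (j / N))"
            by (intro tendsto_intros)
          from continuous_on_tendsto_compose[OF cont this]
          show "(\<lambda>n. G (w (k n) (j / N)) (w (k n) (Suc j / N) - w (k n) (j / N)))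
              \<longlonglongrightarrow> G (g (j / N)) (g (Suc j / N) - g (j / N))" by simp
        qed
        moreover have "(\<lambda>n. Fcal G (u (k n)) + e * \<Lambda>) \<longlonglongrightarrow> c + e * \<Lambda>"
          using c by (intro tendsto_intros)
        moreover have "P (w n) N \<le> Fcal G (u n) + e * \<Lambda>" for n
        proof -
          have "P (w n) N \<le> integral {0..1} (\<lambda>s. G (u n s) (v n s)) + e * l n"
            unfolding P_def w_def l_def
            using v prim \<gamma>(1,2,3) \<gamma>K d N by (intro reparametrized_polygon_sum_le[where K = K and d = d]) auto
          also have "\<dots> \<le> Fcal G (u n) + e * \<Lambda>" using l[of n] \<open>e > 0\<close> by (simp add: Fcal)
          finally show ?thesis .
        qed
        ultimately have "P g N \<le> c + e * \<Lambda>" by (intro LIMSEQ_le) auto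
        moreover have "P W N = P g N"
          unfolding P_def using in01 by (intro sum.cong refl) (simp add: Wg del: of_nat_Suc)
        ultimately show ?thesis by simp
      qed
      moreover have "\<forall>\<^sub>F N in sequentially. N > 0 \<and> K / real N < d"
      proof -
        have "(\<lambda>N. K / real N) \<longlonglongrightarrow> 0" by (rule lim_const_over_n)
        then have "\<forall>\<^sub>F N in sequentially. K / real N < d" using \<open>d > 0\<close> by (rule order_tendstoD)
        with eventually_gt_at_top[of 0] show ?thesis by eventually_elim simp
      qed
      ultimately have "\<forall>\<^sub>F N in sequentially. P W N \<le> c + e * \<Lambda>"
        by (auto elim: eventually_mono)
      moreover have "P W \<longlonglongrightarrow> Fcal G W"
        using polygon_sum_tendsto[OF W_lip E] unfolding FcalW P_def .
      ultimately show ?thesis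
        by (intro tendsto_upperbound[of "P W"]) auto
    qed
    have "Fcal G W \<le> c + e" if "e > 0" for e
    proof -
      \<comment> \<open>Dividing by \<open>K = \<Lambda> + 1\<close> avoids a division by
        \<open>\<Lambda>\<close>, which may be 0.\<close>
      have "Fcal G W \<le> c + e / K * \<Lambda>" using that \<open>K > 0\<close> by (intro bound) simp
      also have "e / K * \<Lambda> \<le> e"
        using \<open>e > 0\<close> \<open>K > 0\<close> by (simp add: field_simps K_def)
      finally show ?thesis by simp
    qed
    then show ?thesis by (rule field_le_epsilon)
  qed
  with k W_lip W that show thesis by blast
qed

section \<open>Existence of minimizers\<close>

text \<open>Linearity in \<open>q\<close> gives convexity for both signs, and Cauchy-Schwarz gives
  the modulus with \<open>d = e\<close>.\<close>

lemma lagrangian_symplectic: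
  assumes "\<bar>c\<bar> = 1"
  shows "lagrangian (\<lambda>p q :: complex. c * (p \<bullet> (\<i> * q)))"
proof
  show "continuous_on UNIV (\<lambda>(p, q). c * (p \<bullet> (\<i> * q)))"
    by (auto simp: case_prod_beta intro!: continuous_intros)
  show "convex_on UNIV (\<lambda>q. c * (p \<bullet> (\<i> * q)))" for p
    by (rule convex_onI) (simp_all add: inner_add_right algebra_simps)
  show "c * (p \<bullet> (\<i> * (r *\<^sub>R q))) = r * (c * (p \<bullet> (\<i> * q)))" for r p q
    by simp
  fix e :: real assume "e > 0"
  have "\<bar>c * (p \<bullet> (\<i> * q)) - c * (p' \<bullet> (\<i> * q))\<bar> \<le> e * norm q" if "norm (p - p') < e" for p p' q
  proof -
    have "\<bar>c * (p \<bullet> (\<i> * q)) - c * (p' \<bullet> (\<i> * q))\<bar> = \<bar>(p - p') \<bullet> (\<i> * q)\<bar>"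
      using assms by (simp add: right_diff_distrib[symmetric] inner_diff_left abs_mult)
    also have "\<dots> \<le> norm (p - p') * norm (\<i> * q)" by (rule Cauchy_Schwarz_ineq2)
    also have "\<dots> \<le> e * norm q" using that by (simp add: norm_mult mult_right_mono)
    finally show ?thesis .
  qed
  with \<open>e > 0\<close> show "\<exists>d>0. \<forall>p p' q. norm (p - p') < d \<longrightarrow>
      \<bar>c * (p \<bullet> (\<i> * q)) - c * (p' \<bullet> (\<i> * q))\<bar> \<le> e * norm q" by blast
qed

section \<open>Periodic integrands, lattice translations and admissible curves\<close>

definition lattice_floor :: "complex \<Rightarrow> complex" where
  "lattice_floor p = Complex (of_int \<lfloor>Re p\<rfloor>) (of_int \<lfloor>Im p\<rfloor>)"

lemma norm_minus_lattice_floor_le: "cmod (p - lattice_floor p) \<le> 2"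
proof -
  have "\<bar>Re (p - lattice_floor p)\<bar> \<le> 1" "\<bar>Im (p - lattice_floor p)\<bar> \<le> 1"
    unfolding lattice_floor_def by (simp_all, linarith+)
  then show ?thesis using cmod_le[of "p - lattice_floor p"] by linarith
qed

text \<open>What has to be shown is the modulus: periodicity moves positions into a compact set,
  homogeneity reduces velocities to the unit sphere, and there continuity is uniform.\<close>

lemma lagrangian_periodic:
  fixes F :: "complex \<Rightarrow> complex \<Rightarrow> real"
  assumes cont: "continuous_on UNIV (\<lambda>(p, q). F p q)"
    and convex: "\<And>p q1 q2 \<theta>. \<theta> \<in> {0..1} \<Longrightarrow>
        F p (\<theta> *\<^sub>R q1 + (1 - \<theta>) *\<^sub>R q2) \<le> \<theta> * F p q1 + (1 - \<theta>) * F p q2"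
    and homog: "\<And>p q c. c > 0 \<Longrightarrow> F p (c *\<^sub>R q) = c * F p q"
    and per: "\<And>p q (a::int) (b::int). F (p + Complex (of_int a) (of_int b)) q = F p q"
  shows "lagrangian F"
proof
  show "continuous_on UNIV (\<lambda>(p, q). F p q)" by fact
  show "convex_on UNIV (F p)" for p
    using convex[of _ p]
    by (intro convex_onI) (auto simp: add.commute[of "(1 - _) *\<^sub>R _"] add.commute[of "(1 - _) * _"])
  show "F p (c *\<^sub>R q) = c * F p q" if "c > 0" for c p q using homog[OF that] .
  have F0: "F p 0 = 0" for p using homog[of 2 p 0] by simp
  fix e :: real assume "e > 0"
  \<comment> \<open>Radius 3: after a lattice translation \<open>p\<close> has norm at most 2, and
    \<open>p'\<close> lies within 1 of it because the distance is less than
    \<open>min d 1\<close>.\<close>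
  have "uniformly_continuous_on (cball 0 3 \<times> sphere 0 1) (\<lambda>(p, q). F p q)"
    by (intro compact_uniformly_continuous continuous_on_subset[OF cont] compact_Times) auto
  then obtain d where "d > 0" and d: "\<And>z z'. \<lbrakk>z \<in> cball 0 3 \<times> sphere 0 1; z' \<in> cball 0 3 \<times> sphere 0 1; dist z' z < d\<rbrakk>
      \<Longrightarrow> dist ((\<lambda>(p, q). F p q) z') ((\<lambda>(p, q). F p q) z) < e"
    using \<open>e > 0\<close> unfolding uniformly_continuous_on_def by metis
  have unit: "\<bar>F p q - F p' q\<bar> \<le> e" if "norm (p - p') < min d 1" "norm q = 1" for p p' q
  proof -
    define c where "c = lattice_floor p"
    have shift: "F (p'' - c) q = F p'' q" for p''
      using per[of "p'' - c" "\<lfloor>Re p\<rfloor>" "\<lfloor>Im p\<rfloor>" q] by (simp add: c_def lattice_floor_def)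
    have "norm (p - c) \<le> 2" using norm_minus_lattice_floor_le by (simp add: c_def)
    moreover have "norm (p' - c) \<le> norm (p - c) + norm (p - p')"
      using norm_triangle_ineq4[of "p - c" "p - p'"] by simp
    ultimately have "norm (p' - c) \<le> 3" "norm (p - c) \<le> 3" using that by auto
    then have "dist (F (p - c) q) (F (p' - c) q) < e"
      using d[of "(p' - c, q)" "(p - c, q)"] that by (simp add: dist_Pair_Pair) (simp add: dist_norm)
    then show ?thesis by (simp add: shift dist_real_def)
  qed
  have "\<bar>F p q - F p' q\<bar> \<le> e * norm q" if "norm (p - p') < min d 1" for p p' q
  proof (cases "q = 0")
    case False
    define r where "r = q /\<^sub>R norm q"
    have q: "q = norm q *\<^sub>R r" "norm r = 1" "norm q > 0" using False by (simp_all add: r_def)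
    have "\<bar>F p q - F p' q\<bar> = \<bar>norm q * (F p r - F p' r)\<bar>"
      using homog[OF q(3), of p r] homog[OF q(3), of p' r] q(1) by (simp add: right_diff_distrib)
    also have "\<dots> = norm q * \<bar>F p r - F p' r\<bar>" by (simp add: abs_mult)
    also have "\<dots> \<le> norm q * e" using unit[OF that q(2)] by (intro mult_left_mono) auto
    finally show ?thesis by (simp add: mult.commute)
  qed (simp add: F0)
  then show "\<exists>d>0. \<forall>p p' q. norm (p - p') < d \<longrightarrow> \<bar>F p q - F p' q\<bar> \<le> e * norm q"
    using \<open>d > 0\<close> by (intro exI[of _ "min d 1"]) auto
qed

text \<open>The area is invariant because the extra term is \<open>c\<close> paired with the rotated
  integral of the derivative, which vanishes for a closed curve.\<close>

lemma W11per_translate: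
  assumes "u \<in> W11per"
  shows "(\<lambda>t. u t - c) \<in> W11per" "Fcal G (\<lambda>t. u t - c) = Fcal (\<lambda>p. G (p - c)) u"
    "Acal (\<lambda>t. u t - c) = Acal u"
proof -
  have "W11loc (\<lambda>t. u t - c)" using assms by (simp add: W11per_def W11loc_def)
  then show uc: "(\<lambda>t. u t - c) \<in> W11per" using assms by (simp add: W11per_def)
  \<comment> \<open>\<open>vector_derivative\<close> is a choice among derivatives; equivalence for
    every \<open>D\<close> gives equality also where no derivative exists.\<close>
  have "((\<lambda>t. u t - c) has_vector_derivative D) (at t) \<longleftrightarrow> (u has_vector_derivative D) (at t)" for D t
    using has_vector_derivative_diff[OF _ has_vector_derivative_const, of u D "at t" c]
      has_vector_derivative_add[OF _ has_vector_derivative_const, of "\<lambda>t. u t - c" D "at t" c] by auto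
  then have "vector_derivative (\<lambda>t. u t - c) (at t) = vector_derivative u (at t)" for t
    by (simp add: vector_derivative_def)
  then show F: "Fcal G (\<lambda>t. u t - c) = Fcal (\<lambda>p. G (p - c)) u" for G
    by (simp add: Fcal_def)
  obtain v where v: "v absolutely_integrable_on {0..1}"
    "\<And>a b. a \<le> b \<Longrightarrow> (v has_integral (u b - u a)) {a..b}"
    and Fv: "\<And>G. Fcal G u = integral {0..1} (\<lambda>t. G (u t) (v t))"
    by (rule W11per_derivative[OF assms]) blast
  have "u 1 = u 0" using assms by (auto simp: W11per_def dest: spec[of _ 0])
  then have "(v has_integral 0) {0..1}" using v(2)[of 0 1] by simp
  from has_integral_linear[OF this bounded_linear_compose[OF bounded_linear_inner_right[of c]
      bounded_linear_mult_right[of "\<i>"]]]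
  have "((\<lambda>t. c \<bullet> (\<i> * v t)) has_integral 0) {0..1}"
    by (simp add: o_def)
  moreover have "continuous_on {0..1} u"
    using v(2) by (intro continuous_on_primitive) auto
  then have "(\<lambda>t. u t \<bullet> (\<i> * v t)) integrable_on {0..1}"
    using lagrangian.absolutely_integrable[OF lagrangian_symplectic[of 1], of 0 1 u v] v(1)
    by (simp add: absolutely_integrable_on_def)
  ultimately have "integral {0..1} (\<lambda>t. (u t - c) \<bullet> (\<i> * v t)) = integral {0..1} (\<lambda>t. u t \<bullet> (\<i> * v t))"
    by (simp add: inner_diff_left integral_diff has_integral_integrable integral_unique)
  then show "Acal (\<lambda>t. u t - c) = Acal u"
    using F[of "\<lambda>p q. p \<bullet> (\<i> * q)"] Fv[of "\<lambda>p q. (p - c) \<bullet> (\<i> * q)"] Fv[of "\<lambda>p q. p \<bullet> (\<i> * q)"]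
    by (simp add: Acal_def Fcal_def)
qed

text \<open>A circle of area \<open>\<bar>\<tau>\<bar>\<close>, traversed once. In the convention of
  \<open>Acal\<close> counterclockwise motion has negative area, hence
  \<open>s = - sgn \<tau>\<close>; for \<open>\<tau> = 0\<close> the curve is constant. Nonemptiness
  makes the infimum in \<open>S_F\<close> approachable by admissible curves.\<close>

lemma Mset_nonempty: "Mset \<tau> \<noteq> {}"
proof -
  define s :: real where "s = - sgn \<tau>"
  define r where "r = sqrt (\<bar>\<tau>\<bar> / pi)"
  have r2: "r * r = \<bar>\<tau>\<bar> / pi" by (simp add: r_def)
  define u where "u t = of_real r * cis (2 * pi * s * t)" for t
  define v where "v t = of_real (2 * pi * s) * (\<i> * u t)" for t
  have der: "(u has_vector_derivative v t) (at t within S)" for t S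
  proof -
    define \<omega> where "\<omega> = \<i> * of_real (2 * pi * s)"
    have "((\<lambda>z. of_real r * exp (\<omega> * z)) has_field_derivative \<omega> * (of_real r * exp (\<omega> * of_real t))) (at (of_real t))"
      by (auto intro!: derivative_eq_intros)
    then have "((\<lambda>t. of_real r * exp (\<omega> * of_real t)) has_vector_derivative
        \<omega> * (of_real r * exp (\<omega> * of_real t))) (at t within S)"
      by (rule has_vector_derivative_real_field)
    then show ?thesis
      by (simp add: u_def[abs_def] v_def cis_conv_exp \<omega>_def mult_ac)
  qed
  have contv: "continuous_on S v" for S
    unfolding v_def u_def by (intro continuous_intros)
  have "W11loc u"
    unfolding W11loc_def
  proof (intro exI allI impI conjI)
    fix a b :: real assume ab: "a \<le> b"
    show "v absolutely_integrable_on {a..b}" by (intro absolutely_integrable_continuous_real contv)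
    show "(v has_integral (u b - u a)) {a..b}"
      using ab der by (rule fundamental_theorem_of_calculus)
  qed
  moreover have "u (t + 1) = u t" for t
  proof -
    have "cis (2 * pi * s) = 1" by (cases "\<tau> = 0") (auto simp: s_def sgn_if cis.ctr complex_eq_iff)
    then show ?thesis by (simp add: u_def distrib_left cis_mult[symmetric])
  qed
  ultimately have "u \<in> W11per" by (simp add: W11per_def)
  moreover have "Acal u = \<tau>"
  proof -
    have "u t \<bullet> (\<i> * vector_derivative u (at t)) = 2 * \<tau>" for t
    proof -
      have "\<i> * v t = of_real (- (2 * pi * s)) * u t" by (simp add: v_def algebra_simps)
      then have "u t \<bullet> (\<i> * v t) = - (2 * pi * s) * (u t \<bullet> u t)"
        by (metis inner_scaleR_right scaleR_conv_of_real)
      also have "u t \<bullet> u t = \<bar>\<tau>\<bar> / pi"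
        by (simp add: dot_square_norm u_def norm_mult power_mult_distrib power2_eq_square r2)
      also have "- (2 * pi * s) * (\<bar>\<tau>\<bar> / pi) = 2 * \<tau>" by (simp add: s_def sgn_mult_abs)
      finally show ?thesis using vector_derivative_at[OF der] by simp
    qed
    then show ?thesis by (simp add: Acal_def)
  qed
  ultimately show ?thesis by (auto simp: Mset_def)
qed

lemma Fcal_symplectic: "Fcal (\<lambda>p q. c * (p \<bullet> (\<i> * q))) u = c * (2 * Acal u)"
  by (simp add: Fcal_def Acal_def)

text \<open>Coercivity: this gives the length bound along a minimizing sequence. Being a
  \<open>lagrangian\<close> makes the energy density integrable, so the pointwise bound may be
  integrated.\<close>

lemma length_le_Fcal:
  assumes "u \<in> W11per" "lagrangian F" "\<And>p q. m * cmod q \<le> F p q"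
  shows "m * Fcal (\<lambda>p q. cmod q) u \<le> Fcal F u"
proof -
  obtain v where v: "v absolutely_integrable_on {0..1}"
    "\<And>a b. a \<le> b \<Longrightarrow> (v has_integral (u b - u a)) {a..b}"
    and Fcal: "\<And>G. Fcal G u = integral {0..1} (\<lambda>t. G (u t) (v t))"
    by (rule W11per_derivative[OF assms(1)]) blast
  have "(\<lambda>t. F (u t) (v t)) integrable_on {0..1}"
    using lagrangian.absolutely_integrable[OF assms(2) continuous_on_primitive[OF v(2)] v(1)]
    by (auto simp: absolutely_integrable_on_def)
  moreover have "(\<lambda>t. m * cmod (v t)) integrable_on {0..1}"
    using v(1) by (auto simp: absolutely_integrable_on_def intro: integrable_on_mult_right)
  ultimately have "integral {0..1} (\<lambda>t. m * cmod (v t)) \<le> integral {0..1} (\<lambda>t. F (u t) (v t))"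
    using assms(3) by (intro integral_le)
  then show ?thesis by (simp add: Fcal)
qed

section \<open>Minimizing sequence and passage to the limit\<close>

theorem theorem1p2p1:
  fixes F :: "complex \<Rightarrow> complex \<Rightarrow> real"
  assumes cont: "continuous_on UNIV (\<lambda>(p, q). F p q)"
    and convex: "\<And>p q1 q2 \<theta>. \<theta> \<in> {0..1} \<Longrightarrow>
        F p (\<theta> *\<^sub>R q1 + (1 - \<theta>) *\<^sub>R q2) \<le> \<theta> * F p q1 + (1 - \<theta>) * F p q2"
    and homog: "\<And>p q c. c > 0 \<Longrightarrow> F p (c *\<^sub>R q) = c * F p q"
    and bounds: "\<exists>m1 m2. m1 > 0 \<and> m2 > 0 \<and>
        (\<forall>p q. m1 * cmod q \<le> F p q \<and> F p q \<le> m2 * cmod q)"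
    and per: "\<And>p q (a::int) (b::int). F (p + Complex (of_int a) (of_int b)) q = F p q"
  shows "\<exists>u. u \<in> Mset \<tau> \<and> (\<exists>L. L-lipschitz_on UNIV u) \<and> (\<forall>t. u (t + 1) = u t)
             \<and> Fcal F u = S_F F \<tau>"
proof -
  obtain m where "m > 0" and m: "\<And>p q. m * cmod q \<le> F p q" using bounds by blast
  have lagr: "lagrangian F" using cont convex homog per by (rule lagrangian_periodic)
  define S where "S = S_F F \<tau>"
  have nonneg: "0 \<le> F p q" for p q
    using m[of q p] \<open>m > 0\<close> by (meson less_imp_le mult_nonneg_nonneg norm_ge_zero order_trans)
  \<comment> \<open>A non-integrable integrand has integral 0 by convention, so the bound covers
    every \<open>u\<close>.\<close>
  have "0 \<le> Fcal F u" for u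
    unfolding Fcal_def
    by (cases "(\<lambda>t. F (u t) (vector_derivative u (at t))) integrable_on {0..1}")
      (simp_all add: integral_nonneg nonneg not_integrable_integral)
  then have bdd: "bdd_below (Fcal F ` Mset \<tau>)" by (intro bdd_belowI2)
  then have S_le: "S \<le> Fcal F u" if "u \<in> Mset \<tau>" for u
    using that unfolding S_def S_F_def by (rule cINF_lower)
  have "\<exists>u. u \<in> Mset \<tau> \<and> Fcal F u < S + inverse (real (Suc n)) \<and> cmod (u 0) \<le> 2" for n
  proof -
    have "Inf (Fcal F ` Mset \<tau>) < S + inverse (real (Suc n))"
      by (simp add: S_def S_F_def del: of_nat_Suc)
    then obtain u where u: "u \<in> Mset \<tau>" "Fcal F u < S + inverse (real (Suc n))"
      using cInf_lessD[of "Fcal F ` Mset \<tau>"] Mset_nonempty[of \<tau>] by blast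
    then have uW: "u \<in> W11per" by (simp add: Mset_def)
    \<comment> \<open>Translating by a lattice vector keeps the energy by periodicity and the area
      by closedness, and brings the base point to within 2 of the origin, as compactness
      requires.\<close>
    define c where "c = lattice_floor (u 0)"
    have "(\<lambda>p. F (p - c)) = F"
    proof (intro ext)
      show "F (p - c) q = F p q" for p q
        using per[of "p - c" "\<lfloor>Re (u 0)\<rfloor>" "\<lfloor>Im (u 0)\<rfloor>" q] by (simp add: c_def lattice_floor_def)
    qed
    then have "Fcal F (\<lambda>t. u t - c) = Fcal F u"
      by (simp add: W11per_translate(2)[OF uW])
    moreover have "(\<lambda>t. u t - c) \<in> Mset \<tau>"
      using u(1) W11per_translate(1,3)[OF uW, of c] by (simp add: Mset_def)
    moreover have "cmod (u 0 - c) \<le> 2" unfolding c_def by (rule norm_minus_lattice_floor_le)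
    ultimately show ?thesis using u(2) by (intro exI[of _ "\<lambda>t. u t - c"]) auto
  qed
  then obtain u where u: "\<And>n. u n \<in> Mset \<tau>"
    and small: "\<And>n. Fcal F (u n) < S + inverse (real (Suc n))" and base: "\<And>n. cmod (u n 0) \<le> 2"
    by metis
  have uW: "u n \<in> W11per" and uA: "Acal (u n) = \<tau>" for n using u[of n] by (auto simp: Mset_def)
  have len: "Fcal (\<lambda>p q. cmod q) (u n) \<le> (S + 1) / m" for n
  proof -
    have "inverse (real (Suc n)) \<le> 1" by (simp add: field_simps)
    then have "m * Fcal (\<lambda>p q. cmod q) (u n) \<le> S + 1"
      using length_le_Fcal[OF uW[of n] lagr m] small[of n] by linarith
    then show ?thesis using \<open>m > 0\<close> by (simp add: pos_le_divide_eq mult.commute)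
  qed
  obtain W L k where k: "strict_mono (k :: nat \<Rightarrow> nat)" and L: "L-lipschitz_on UNIV W"
    and W: "W \<in> W11per"
    and lsc: "\<And>G c. \<lbrakk>lagrangian G; (\<lambda>n. Fcal G (u (k n))) \<longlonglongrightarrow> c\<rbrakk> \<Longrightarrow> Fcal G W \<le> c"
    by (rule closed_curve_compactness[of u, OF uW len base]) blast
  have "(\<lambda>n. Fcal F (u n)) \<longlonglongrightarrow> S"
  proof (rule real_tendsto_sandwich[OF _ _ tendsto_const LIMSEQ_inverse_real_of_nat_add])
    show "\<forall>\<^sub>F n in sequentially. S \<le> Fcal F (u n)" using S_le[OF u] by simp
    show "\<forall>\<^sub>F n in sequentially. Fcal F (u n) \<le> S + inverse (real (Suc n))"
      using small by (intro always_eventually allI less_imp_le)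
  qed
  then have "(\<lambda>n. Fcal F (u (k n))) \<longlonglongrightarrow> S"
    using LIMSEQ_subseq_LIMSEQ[OF _ k] by (simp add: o_def)
  then have le: "Fcal F W \<le> S" by (rule lsc[OF lagr])
  \<comment> \<open>The areas along the sequence are constantly \<open>\<tau>\<close>, so
    semicontinuity with both signs pins down the area of \<open>W\<close>.\<close>
  have "c * (2 * Acal W) \<le> c * (2 * \<tau>)" if "\<bar>c\<bar> = 1" for c
    using lsc[OF lagrangian_symplectic[OF that]] by (simp add: Fcal_symplectic uA)
  from this[of 1] this[of "-1"] have "Acal W = \<tau>" by simp
  with W have "W \<in> Mset \<tau>" by (simp add: Mset_def)
  moreover have "\<forall>t. W (t + 1) = W t" using W by (simp add: W11per_def)
  moreover have "Fcal F W = S_F F \<tau>"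
    using le S_le[OF \<open>W \<in> Mset \<tau>\<close>] by (simp add: S_def)
  ultimately show ?thesis using L by blast
qed

end
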